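(* Let $z>0$, $p=1/2$, and let $$(A,B)\overset{d}{=}I_p(1-L,0)+(1-I_p)(1,R),$$ where $I_p\sim Be(p)$ is independent of the $[0,1)^2$-valued random vector $(L,R)$, with $2L\overset{d}{=}2R\sim\beta(1,z)$. Set $a=b=z+1$. Then all of the following hold. (i) For $V_2\sim\Gamma_b$, $V_1\sim\Gamma_a$ is the unique (in distribution) solution to $V_1\overset{d}{=}AV_1+BV_2$, where $V_1,V_2,(A,B)$ are mutually independent. (ii) $X\sim\beta(a,b)$ is the unique (in distribution) solution to $X\overset{d}{=}AX+B(1-X)$, where $X$ is independent of $(A,B)$. (iii) There is a random variable $Y\sim\beta(a,b)$ such that, as $n\to\infty$, $Y_n(x)\to Y$ almost surely, uniformly in $x\in[0,1]$. (iv) For every $x\in[0,1]$, $X_n(x)$ converges in distribution to $\beta(a,b)$ as $n\to\infty$. (v) For every $x'\in(0,\infty)$, $X'_n(x')$ converges in distribution to $\Gamma_a$ as $n\to\infty$.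
   Context: $\overset{d}{=}$ denotes equality in distribution. $Be(p)$ is the Bernoulli distribution with success probability $p$. $\beta(a,b)$, $a,b>0$, is the beta distribution with density $B(a,b)^{-1}u^{a-1}(1-u)^{b-1}$ on $(0,1)$. $\Gamma_a$, $a>0$, is the gamma distribution with shape $a$ and scale $1$. $F_1\otimes F_2$ denotes the joint law of independent random elements with laws $F_1$, $F_2$. A solution of a random equation is a real random variable (or its law) satisfying it; uniqueness is in distribution. No assumption is made on the dependence between $L$ and $R$. Let $\mu$ be the law of $(A,B)$ and let $(A_1,B_1,V_1),(A_2,B_2,V_2),\dots$ be i.i.d. with law $\mu\otimes\Gamma_b$. Put $F_n(x)=A_nx+B_n(1-x)$ for $x\in[0,1]$ and $G_n(x')=A_nx'+B_nV_n$ for $x'\in(0,\infty)$. Define, for $n\ge1$, $X_n=F_n\circ F_{n-1}\circ\cdots\circ F_1$ (forward iteration), $Y_n=F_1\circ F_2\circ\cdots\circ F_n$ (backward iteration), and $X'_n=G_n\circ G_{n-1}\circ\cdots\circ G_1$. *)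

theory Defs
  imports "HOL-Probability.Probability"
begin

text \<open>
  The library constant \<open>indep_var\<close> requires both random variables to have values in the same type,
  hence the following version for arbitrary types.
\<close>

definition (in prob_space) indep_rv ::
  "'b measure \<Rightarrow> ('a \<Rightarrow> 'b) \<Rightarrow> 'c measure \<Rightarrow> ('a \<Rightarrow> 'c) \<Rightarrow> bool" where
  "indep_rv S X T Y \<longleftrightarrow> random_variable S X \<and> random_variable T Y \<and>
     indep_set {X -` E \<inter> space M | E. E \<in> sets S} {Y -` E \<inter> space M | E. E \<in> sets T}"

lemma (in prob_space) indep_rv_distr:
  assumes "indep_rv S X T Y"
  shows "distr M S X \<Otimes>\<^sub>M distr M T Y = distr M (S \<Otimes>\<^sub>M T) (\<lambda>\<omega>. (X \<omega>, Y \<omega>))"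
proof -
  have [measurable]: "random_variable S X" "random_variable T Y"
    using assms by (auto simp: indep_rv_def)
  interpret X: prob_space "distr M S X" by (rule prob_space_distr) measurable
  interpret Y: prob_space "distr M T Y" by (rule prob_space_distr) measurable
  have prod: "prob (X -` E \<inter> space M \<inter> (Y -` E' \<inter> space M)) =
      prob (X -` E \<inter> space M) * prob (Y -` E' \<inter> space M)"
    if "E \<in> sets S" "E' \<in> sets T" for E E'
    using assms that unfolding indep_rv_def by (intro indep_setD) auto
  show ?thesis
  proof (rule pair_measure_eqI)
    fix E E' assume E: "E \<in> sets (distr M S X)" "E' \<in> sets (distr M T Y)"
    have eq: "(\<lambda>\<omega>. (X \<omega>, Y \<omega>)) -` (E \<times> E') \<inter> space M =
        X -` E \<inter> space M \<inter> (Y -` E' \<inter> space M)" by auto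
    show "emeasure (distr M S X) E * emeasure (distr M T Y) E' =
        emeasure (distr M (S \<Otimes>\<^sub>M T) (\<lambda>\<omega>. (X \<omega>, Y \<omega>))) (E \<times> E')"
      using E prod[of E E']
      by (simp add: emeasure_distr eq emeasure_eq_measure ennreal_mult'[symmetric])
  qed (auto simp: X.sigma_finite_measure_axioms Y.sigma_finite_measure_axioms)
qed

definition beta_law :: "real \<Rightarrow> real \<Rightarrow> real measure" where
  "beta_law a b = density lborel (\<lambda>u. ennreal
     (if 0 < u \<and> u < 1 then u powr (a - 1) * (1 - u) powr (b - 1) / Beta a b else 0))"

definition gamma_law :: "real \<Rightarrow> real measure" where
  "gamma_law a = density lborel (\<lambda>v. ennreal
     (if 0 < v then v powr (a - 1) * exp (- v) / Gamma a else 0))"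

text \<open>
  In the following two predicates \<open>\<mu>\<close> is the law of \<open>(A, B)\<close>, and the independence of the random
  elements is expressed by taking the product of their laws as joint law. A solution is a
  probability measure on the whole real line; no restriction on its support is imposed. The lemmas
  at the end of this theory relate the predicates to random variables on an arbitrary
  probability space.
\<close>

definition solves_V_eq ::
  "(real \<times> real) measure \<Rightarrow> real measure \<Rightarrow> real measure \<Rightarrow> bool" where
  "solves_V_eq \<mu> \<gamma> \<nu> \<longleftrightarrow> prob_space \<nu> \<and> sets \<nu> = sets borel \<and>
     \<nu> = distr (\<nu> \<Otimes>\<^sub>M (\<gamma> \<Otimes>\<^sub>M \<mu>)) borel (\<lambda>(v1, v2, A, B). A * v1 + B * v2)"

definition solves_X_eq :: "(real \<times> real) measure \<Rightarrow> real measure \<Rightarrow> bool" where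
  "solves_X_eq \<mu> \<nu> \<longleftrightarrow> prob_space \<nu> \<and> sets \<nu> = sets borel \<and>
     \<nu> = distr (\<nu> \<Otimes>\<^sub>M \<mu>) borel (\<lambda>(x, A, B). A * x + B * (1 - x))"

text \<open>Iterations of maps \<open>f 1, f 2, \<dots>\<close>; the map \<open>f 0\<close> is not used.\<close>

primrec forward_iter :: "(nat \<Rightarrow> 'a \<Rightarrow> 'a) \<Rightarrow> nat \<Rightarrow> 'a \<Rightarrow> 'a" where
  "forward_iter f 0 = id"
| "forward_iter f (Suc n) = f (Suc n) \<circ> forward_iter f n"

primrec backward_iter :: "(nat \<Rightarrow> 'a \<Rightarrow> 'a) \<Rightarrow> nat \<Rightarrow> 'a \<Rightarrow> 'a" where
  "backward_iter f 0 = id"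
| "backward_iter f (Suc n) = backward_iter f n \<circ> f (Suc n)"

definition F_map :: "real \<Rightarrow> real \<Rightarrow> real \<Rightarrow> real" where
  "F_map A B x = A * x + B * (1 - x)"

definition G_map :: "real \<Rightarrow> real \<Rightarrow> real \<Rightarrow> real \<Rightarrow> real" where
  "G_map A B V x = A * x + B * V"

lemma (in prob_space) solves_V_eq_iff:
  fixes V1 V2 A B :: "'a \<Rightarrow> real"
  assumes "indep_rv borel V1 borel (\<lambda>\<omega>. (V2 \<omega>, A \<omega>, B \<omega>))"
    and "indep_rv borel V2 borel (\<lambda>\<omega>. (A \<omega>, B \<omega>))"
  shows "solves_V_eq (distr M borel (\<lambda>\<omega>. (A \<omega>, B \<omega>))) (distr M borel V2) (distr M borel V1) \<longleftrightarrow>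
    distr M borel V1 = distr M borel (\<lambda>\<omega>. A \<omega> * V1 \<omega> + B \<omega> * V2 \<omega>)"
proof -
  have m: "random_variable borel V1" "random_variable borel V2"
      "random_variable borel (\<lambda>\<omega>. (A \<omega>, B \<omega>))" "random_variable borel (\<lambda>\<omega>. (V2 \<omega>, A \<omega>, B \<omega>))"
    using assms by (auto simp: indep_rv_def)
  have "distr M borel V2 \<Otimes>\<^sub>M distr M borel (\<lambda>\<omega>. (A \<omega>, B \<omega>)) = distr M borel (\<lambda>\<omega>. (V2 \<omega>, A \<omega>, B \<omega>))"
    using indep_rv_distr[OF assms(2)] by (simp add: borel_prod)
  moreover have "distr M borel V1 \<Otimes>\<^sub>M distr M borel (\<lambda>\<omega>. (V2 \<omega>, A \<omega>, B \<omega>)) =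
      distr M borel (\<lambda>\<omega>. (V1 \<omega>, V2 \<omega>, A \<omega>, B \<omega>))"
    using indep_rv_distr[OF assms(1)] by (simp add: borel_prod)
  moreover have "(\<lambda>\<omega>. (V1 \<omega>, V2 \<omega>, A \<omega>, B \<omega>)) \<in> M \<rightarrow>\<^sub>M borel"
    using m unfolding borel_prod[symmetric] by measurable
  moreover have "(\<lambda>(v1, v2, A, B). A * v1 + B * v2 :: real) \<in> borel \<rightarrow>\<^sub>M borel"
    unfolding borel_prod[symmetric] by measurable
  ultimately show ?thesis
    using m(1) by (simp add: solves_V_eq_def prob_space_distr distr_distr comp_def)
qed

lemma (in prob_space) solves_X_eq_iff:
  fixes X A B :: "'a \<Rightarrow> real"
  assumes "indep_rv borel X borel (\<lambda>\<omega>. (A \<omega>, B \<omega>))"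
  shows "solves_X_eq (distr M borel (\<lambda>\<omega>. (A \<omega>, B \<omega>))) (distr M borel X) \<longleftrightarrow>
    distr M borel X = distr M borel (\<lambda>\<omega>. A \<omega> * X \<omega> + B \<omega> * (1 - X \<omega>))"
proof -
  have m: "random_variable borel X" "random_variable borel (\<lambda>\<omega>. (A \<omega>, B \<omega>))"
    using assms by (auto simp: indep_rv_def)
  have "distr M borel X \<Otimes>\<^sub>M distr M borel (\<lambda>\<omega>. (A \<omega>, B \<omega>)) = distr M borel (\<lambda>\<omega>. (X \<omega>, A \<omega>, B \<omega>))"
    using indep_rv_distr[OF assms] by (simp add: borel_prod)
  moreover have "(\<lambda>\<omega>. (X \<omega>, A \<omega>, B \<omega>)) \<in> M \<rightarrow>\<^sub>M borel"
    using m unfolding borel_prod[symmetric] by measurable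
  moreover have "(\<lambda>(x, A, B). A * x + B * (1 - x) :: real) \<in> borel \<rightarrow>\<^sub>M borel"
    unfolding borel_prod[symmetric] by measurable
  ultimately show ?thesis
    using m(1) by (simp add: solves_X_eq_def prob_space_distr distr_distr comp_def)
qed

end

theory Submission
  imports Defs
begin

text \<open>
  A random affine map \<open>x \<mapsto> C x + D\<close> with \<open>0 \<le> C \<le> 1\<close> and \<open>E C < 1\<close> contracts the Lipschitz constants of
  test functions by the factor \<open>E C\<close>. Hence the expectation of a bounded Lipschitz function after \<open>n\<close>
  steps tends to its integral under any stationary law; applied to \<open>x \<mapsto> exp (i t x)\<close>, this gives
  uniqueness of the stationary law without moment assumptions and weak convergence of the forward
  iterations. Backward iterations have the same one-dimensional laws, and they converge uniformly on
  \<open>[0,1]\<close> because the products \<open>C\<^sub>1 \<cdots> C\<^sub>n\<close> have summable expectations. It remains to see that the beta and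
  gamma laws are stationary: for the beta law this is a computation of densities, and the gamma law
  is obtained from it by multiplication with an independent gamma variable.
\<close>

subsection \<open>Gamma and beta laws\<close>

lemma prob_space_gamma_law:
  assumes "a > 0"
  shows "prob_space (gamma_law a)"
proof
  have "(\<integral>\<^sup>+ v. ennreal (if 0 < v then v powr (a - 1) * exp (- v) / Gamma a else 0) \<partial>lborel)
      = (\<integral>\<^sup>+ v. ennreal (1 / Gamma a) * ennreal (indicator {0..} v * v powr (a - 1) / exp v) \<partial>lborel)"
  proof (rule nn_integral_cong)
    fix v :: real
    have "(if 0 < v then v powr (a - 1) * exp (- v) / Gamma a else 0) =
        1 / Gamma a * (indicator {0..} v * v powr (a - 1) / exp v)"
      by (auto simp: exp_minus divide_simps indicator_def)
    then show "ennreal (if 0 < v then v powr (a - 1) * exp (- v) / Gamma a else 0) =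
        ennreal (1 / Gamma a) * ennreal (indicator {0..} v * v powr (a - 1) / exp v)"
      using Gamma_real_pos[OF assms] by (simp only: ennreal_mult'[symmetric] less_imp_le divide_nonneg_pos)
  qed
  also have "\<dots> = ennreal (1 / Gamma a) * ennreal (Gamma a)"
    by (simp add: nn_integral_cmult Gamma_conv_nn_integral_real[OF assms])
  also have "\<dots> = 1"
    using Gamma_real_pos[OF assms] by (simp add: ennreal_mult'[symmetric])
  finally show "emeasure (gamma_law a) (space (gamma_law a)) = 1"
    by (simp add: gamma_law_def emeasure_density)
qed

lemma sets_gamma_law [simp, measurable_cong]: "sets (gamma_law a) = sets borel"
  and space_gamma_law [simp]: "space (gamma_law a) = UNIV"
  and sets_beta_law [simp, measurable_cong]: "sets (beta_law a b) = sets borel"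
  and space_beta_law [simp]: "space (beta_law a b) = UNIV"
  by (simp_all add: gamma_law_def beta_law_def)

lemma nn_integral_gamma_law:
  assumes [measurable]: "f \<in> borel_measurable borel"
  shows "(\<integral>\<^sup>+ v. f v \<partial>gamma_law a) =
    (\<integral>\<^sup>+ v. ennreal (if 0 < v then v powr (a - 1) * exp (- v) / Gamma a else 0) * f v \<partial>lborel)"
  unfolding gamma_law_def by (rule nn_integral_density) auto

lemma nn_integral_beta_law:
  assumes [measurable]: "f \<in> borel_measurable borel"
  shows "(\<integral>\<^sup>+ v. f v \<partial>beta_law a b) =
    (\<integral>\<^sup>+ u. ennreal (if 0 < u \<and> u < 1 then u powr (a - 1) * (1 - u) powr (b - 1) / Beta a b else 0)
      * f u \<partial>lborel)"
  unfolding beta_law_def by (rule nn_integral_density) auto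

text \<open>If \<open>V\<^sub>1\<close>, \<open>V\<^sub>2\<close> are independent gamma variables, then \<open>V\<^sub>1 + V\<^sub>2\<close> and
  \<open>V\<^sub>1 / (V\<^sub>1 + V\<^sub>2)\<close> are independent.\<close>

lemma beta_gamma_algebra:
  fixes h :: "real \<Rightarrow> real \<Rightarrow> ennreal"
  assumes "a > 0" and "b > 0"
    and h: "case_prod h \<in> borel_measurable (borel \<Otimes>\<^sub>M borel)"
  shows "(\<integral>\<^sup>+ v. \<integral>\<^sup>+ w. h v w \<partial>gamma_law b \<partial>gamma_law a) =
    (\<integral>\<^sup>+ s. \<integral>\<^sup>+ x. h (s * x) (s * (1 - x)) \<partial>beta_law a b \<partial>gamma_law (a + b))"
proof -
  define g where "g c v = (if 0 < v then v powr (c - 1) * exp (- v) / Gamma c else 0)" for c v :: real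
  define k where "k u = (if 0 < u \<and> u < 1 then u powr (a - 1) * (1 - u) powr (b - 1) / Beta a b else 0)"
    for u :: real
  have g[measurable]: "g c \<in> borel_measurable borel" for c unfolding g_def by measurable
  have k[measurable]: "k \<in> borel_measurable borel" unfolding k_def by measurable
  \<comment> \<open>Raw form of the joint measurability, so that \<open>h\<close> can be handled at
    any pair of measurable arguments.\<close>
  have h'[measurable (raw)]: "(\<lambda>w. h (f w) (f' w)) \<in> borel_measurable M"
    if "f \<in> borel_measurable M" "f' \<in> borel_measurable M" for f f' and M :: "'z measure"
    using measurable_compose[OF measurable_Pair[OF that] h] by simp
  \<comment> \<open>For v = s x and w = s (1 - x) the Jacobian is s, the third factor on the left.
    Off 0 < x < 1 both sides vanish, so the identity holds for every x.\<close>
  have jac: "g a (s * x) * g b (s * (1 - x)) * s = g (a + b) s * k x" if "s > 0" for s x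
  proof (cases "0 < x \<and> x < 1")
    case True
    have "s powr (a - 1) * s powr (b - 1) * s = s powr (a + b - 1)"
      using that by (simp add: powr_add[symmetric] powr_mult_base mult.commute flip: powr_add)
    moreover have "exp (- (s * x)) * exp (- (s * (1 - x))) = exp (- s)"
      by (simp add: exp_add[symmetric] algebra_simps)
    moreover have "1 / (Gamma a * Gamma b) = 1 / (Gamma (a + b) * Beta a b)"
      using Gamma_real_pos[of "a + b"] assms by (simp add: Beta_def less_imp_neq[symmetric])
    ultimately have "(s powr (a - 1) * s powr (b - 1) * s) * (exp (- (s * x)) * exp (- (s * (1 - x))))
        * (x powr (a - 1) * (1 - x) powr (b - 1)) * (1 / (Gamma a * Gamma b)) =
      s powr (a + b - 1) * exp (- s) * (x powr (a - 1) * (1 - x) powr (b - 1)) *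
        (1 / (Gamma (a + b) * Beta a b))" by (simp only:)
    then show ?thesis
      using True that by (simp add: g_def k_def powr_mult mult_ac)
  next
    case False
    then show ?thesis using that by (auto simp: g_def k_def zero_less_mult_iff)
  qed
  have g_nonneg: "0 \<le> g a v" "0 \<le> g b v" "0 \<le> g (a + b) v" for v
    using assms by (auto simp: g_def less_imp_le)
  have k_nonneg: "0 \<le> k v" for v
    using assms by (auto simp: k_def Beta_def less_imp_le)
  \<comment> \<open>For s \<le> 0 the numbers v and s - v cannot both be positive. Hence only s > 0
    contributes, where v = s x can be substituted.\<close>
  have zero: "g a v * g b (s - v) = 0" if "s \<le> 0" for s v
    using that by (auto simp: g_def)
  have "(\<integral>\<^sup>+ v. \<integral>\<^sup>+ w. h v w \<partial>gamma_law b \<partial>gamma_law a) =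
      (\<integral>\<^sup>+ v. \<integral>\<^sup>+ w. ennreal (g a v * g b w) * h v w \<partial>lborel \<partial>lborel)"
    by (simp add: nn_integral_gamma_law g_def[symmetric] nn_integral_cmult[symmetric]
        ennreal_mult g_nonneg mult.assoc)
  \<comment> \<open>The shift w = s - v makes the sum s a variable. After Fubini, v is rescaled to s
    x for each fixed s.\<close>
  also have "\<dots> = (\<integral>\<^sup>+ v. \<integral>\<^sup>+ s. ennreal (g a v * g b (s - v)) * h v (s - v) \<partial>lborel \<partial>lborel)"
  proof (rule nn_integral_cong)
    fix v :: real
    show "(\<integral>\<^sup>+ w. ennreal (g a v * g b w) * h v w \<partial>lborel) =
      (\<integral>\<^sup>+ s. ennreal (g a v * g b (s - v)) * h v (s - v) \<partial>lborel)"
      by (subst nn_integral_real_affine[where c = 1 and t = "- v"]) auto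
  qed
  also have "\<dots> = (\<integral>\<^sup>+ s. \<integral>\<^sup>+ v. ennreal (g a v * g b (s - v)) * h v (s - v) \<partial>lborel \<partial>lborel)"
    by (rule lborel_pair.Fubini') measurable
  also have "\<dots> = (\<integral>\<^sup>+ s. \<integral>\<^sup>+ x. ennreal (g (a + b) s * k x) * h (s * x) (s * (1 - x)) \<partial>lborel \<partial>lborel)"
  proof (rule nn_integral_cong)
    fix s :: real
    show "(\<integral>\<^sup>+ v. ennreal (g a v * g b (s - v)) * h v (s - v) \<partial>lborel) =
      (\<integral>\<^sup>+ x. ennreal (g (a + b) s * k x) * h (s * x) (s * (1 - x)) \<partial>lborel)"
    proof (cases "s > 0")
      case True
      have "(\<integral>\<^sup>+ v. ennreal (g a v * g b (s - v)) * h v (s - v) \<partial>lborel) =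
        ennreal s * (\<integral>\<^sup>+ x. ennreal (g a (s * x) * g b (s - s * x)) * h (s * x) (s - s * x) \<partial>lborel)"
        using True by (subst nn_integral_real_affine[where c = s and t = 0]) auto
      also have "\<dots> = (\<integral>\<^sup>+ x. ennreal s * (ennreal (g a (s * x) * g b (s - s * x)) * h (s * x) (s - s * x)) \<partial>lborel)"
        by (rule nn_integral_cmult[symmetric]) measurable
      also have "\<dots> = (\<integral>\<^sup>+ x. ennreal (g (a + b) s * k x) * h (s * x) (s * (1 - x)) \<partial>lborel)"
      proof (rule nn_integral_cong)
        fix x :: real
        have "ennreal s * ennreal (g a (s * x) * g b (s * (1 - x))) = ennreal (g (a + b) s * k x)"
          unfolding jac[OF True, symmetric] using True
          by (simp add: ennreal_mult g_nonneg mult.commute)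
        then show "ennreal s * (ennreal (g a (s * x) * g b (s - s * x)) * h (s * x) (s - s * x)) =
            ennreal (g (a + b) s * k x) * h (s * x) (s * (1 - x))"
          by (simp add: right_diff_distrib mult.assoc[symmetric])
      qed
      finally show ?thesis .
    next
      case False
      then show ?thesis by (simp add: zero) (simp add: g_def)
    qed
  qed
  also have "\<dots> = (\<integral>\<^sup>+ s. \<integral>\<^sup>+ x. h (s * x) (s * (1 - x)) \<partial>beta_law a b \<partial>gamma_law (a + b))"
    by (simp add: nn_integral_gamma_law nn_integral_beta_law g_def[symmetric] k_def[symmetric]
        nn_integral_cmult[symmetric] ennreal_mult g_nonneg k_nonneg mult.assoc)
  finally show ?thesis .
qed

text \<open>For the test function 1, \<open>beta_gamma_algebra\<close> reads 1 = total mass of the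
  beta law, because the three gamma laws have mass 1.\<close>

lemma prob_space_beta_law:
  assumes "a > 0" and "b > 0"
  shows "prob_space (beta_law a b)"
proof
  interpret A: prob_space "gamma_law a" using assms by (intro prob_space_gamma_law)
  interpret B: prob_space "gamma_law b" using assms by (intro prob_space_gamma_law)
  interpret AB: prob_space "gamma_law (a + b)" using assms by (intro prob_space_gamma_law) simp
  show "emeasure (beta_law a b) (space (beta_law a b)) = 1"
    using beta_gamma_algebra[OF assms, of "\<lambda>_ _. 1"]
      A.emeasure_space_1 B.emeasure_space_1 AB.emeasure_space_1 by simp
qed

subsection \<open>Stationarity of the beta law\<close>

text \<open>Since \<open>Beta 1 z = 1 / z\<close> and the power of u has exponent 0, the density
  reduces to one power of 1 - u.\<close>

lemma nn_integral_beta_law_1: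
  assumes "z > 0" and [measurable]: "f \<in> borel_measurable borel"
  shows "(\<integral>\<^sup>+ u. f u \<partial>beta_law 1 z) =
    (\<integral>\<^sup>+ u. ennreal (if 0 < u \<and> u < 1 then z * (1 - u) powr (z - 1) else 0) * f u \<partial>lborel)"
proof -
  have "z \<notin> \<int>\<^sub>\<le>\<^sub>0"
    using assms(1) by (auto elim!: nonpos_Ints_cases)
  then have "Beta 1 z = 1 / z"
    using assms(1) Gamma_real_pos[of z] Gamma_plus1[of z]
    by (simp add: Beta_def add.commute[of 1] less_imp_neq[symmetric])
  then show ?thesis
    unfolding nn_integral_beta_law[OF assms(2)]
    by (intro nn_integral_cong) (auto simp: mult.commute)
qed

text \<open>The integrand is the derivative of w^z (1 - 2 y + w)^z on the range where both factors
  are positive and w < y. At w = y this product is y^z (1 - y)^z, and at the lower end one factor is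
  0.\<close>

lemma nn_integral_sandwiched_product_derivative:
  fixes y z :: real
  assumes "z > 0"
  shows "(\<integral>\<^sup>+ w. ennreal (if max 0 (2 * y - 1) < w \<and> w < y
        then z * w powr (z - 1) * (1 - 2 * y + w) powr z + z * w powr z * (1 - 2 * y + w) powr (z - 1)
        else 0) \<partial>lborel) =
    ennreal (if 0 < y \<and> y < 1 then y powr z * (1 - y) powr z else 0)"
    (is "nn_integral _ (\<lambda>w. ennreal (if ?P w then ?d w else 0)) = _")
proof (cases "0 < y \<and> y < 1")
  case True
  define l where "l = max 0 (2 * y - 1)"
  have l: "l \<le> y" "l \<ge> 0" "l \<ge> 2 * y - 1" and l_cases: "l = 0 \<or> 1 - 2 * y + l = 0"
    using True by (auto simp: l_def max_def)
  have "(?d has_integral (y powr z * (1 - 2 * y + y) powr z - l powr z * (1 - 2 * y + l) powr z)) {l..y}"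
  \<comment> \<open>The interior form is used because for z < 1 the derivative may be unbounded at
    l, while the product itself is continuous on the closed interval.\<close>
  proof (rule fundamental_theorem_of_calculus_interior)
    show "continuous_on {l..y} (\<lambda>w. w powr z * (1 - 2 * y + w) powr z)"
      using l assms by (intro continuous_on_mult continuous_on_powr' continuous_intros) auto
    fix w assume w: "w \<in> {l<..<y}"
    show "((\<lambda>w. w powr z * (1 - 2 * y + w) powr z) has_vector_derivative ?d w) (at w)"
      unfolding has_real_derivative_iff_has_vector_derivative[symmetric]
      using w l assms by (auto intro!: derivative_eq_intros)
  qed (use l in auto)
  then have I: "(?d has_integral (y powr z * (1 - y) powr z)) {l<..<y}"
    using l_cases assms by (auto simp: has_integral_Icc_iff_Ioo)
  have "(\<integral>\<^sup>+ w. ennreal (if ?P w then ?d w else 0) \<partial>lborel) =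
      (\<integral>\<^sup>+ w. ennreal (indicator {l<..<y} w * ?d w) \<partial>lborel)"
    by (intro nn_integral_cong) (simp add: l_def)
  also have "\<dots> = y powr z * (1 - y) powr z"
    using assms I by (intro nn_integral_has_integral_lebesgue) auto
  finally show ?thesis
    using True by simp
next
  case False
  \<comment> \<open>For y \<le> 0 or y \<ge> 1 no w satisfies max 0 (2 y - 1) < w < y.\<close>
  have "(\<integral>\<^sup>+ w. ennreal (if ?P w then ?d w else 0) \<partial>lborel) = (\<integral>\<^sup>+ w. 0 \<partial>(lborel :: real measure))"
    by (intro nn_integral_cong) (use False in auto)
  with False show ?thesis by auto
qed

text \<open>Both kernels \<open>x \<mapsto> (1 - u / 2) x\<close> and \<open>x \<mapsto> x + u / 2 (1 - x)\<close> transport the beta density to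
  an integral over the same range of \<open>w\<close>; the two integrands add up to a derivative in \<open>w\<close>.\<close>

lemma beta_law_fixed_point:
  fixes g :: "real \<Rightarrow> ennreal"
  assumes z: "z > 0" and [measurable]: "g \<in> borel_measurable borel"
  shows "(\<integral>\<^sup>+ x. \<integral>\<^sup>+ u. g ((1 - u / 2) * x) + g (x + u / 2 * (1 - x)) \<partial>beta_law 1 z \<partial>beta_law (z + 1) (z + 1)) =
    2 * (\<integral>\<^sup>+ y. g y \<partial>beta_law (z + 1) (z + 1))"
proof -
  define \<beta> where "\<beta> = Beta (z + 1) (z + 1)"
  have \<beta>: "\<beta> > 0" using z by (simp add: \<beta>_def Beta_def)
  define k where "k u = (if 0 < u \<and> u < 1 then z * (1 - u) powr (z - 1) else 0)" for u
  define f where "f x = (if 0 < x \<and> x < 1 then x powr z * (1 - x) powr z / \<beta> else 0)" for x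
  \<comment> \<open>After passing from u to the image point y, the joint density of (x, y) is
    \<open>q y (2 * y - x)\<close> for the kernel (1 - u / 2) x and \<open>q' y x\<close> for the
    kernel x + u / 2 (1 - x). So w is 2 y - x in the first case and x in the second, and
    \<open>P\<close> describes the same range of w in both.\<close>
  define P where "P y w \<longleftrightarrow> max 0 (2 * y - 1) < w \<and> w < y" for y w :: real
  define q where "q y w = (if P y w then 2 * z * w powr (z - 1) * (1 - 2 * y + w) powr z / \<beta> else 0)" for y w
  define q' where "q' y w = (if P y w then 2 * z * w powr z * (1 - 2 * y + w) powr (z - 1) / \<beta> else 0)" for y w
  have [measurable]: "k \<in> borel_measurable borel" "f \<in> borel_measurable borel"
    "case_prod q \<in> borel_measurable (borel \<Otimes>\<^sub>M borel)"
    "case_prod q' \<in> borel_measurable (borel \<Otimes>\<^sub>M borel)"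
    unfolding k_def f_def q_def q'_def P_def by measurable
  have nonneg: "0 \<le> k u" "0 \<le> f u" "0 \<le> q u v" "0 \<le> q' u v" for u v
    using z \<beta> by (auto simp: k_def f_def q_def q'_def)
  have int_k: "integral\<^sup>N (beta_law 1 z) h = (\<integral>\<^sup>+ u. ennreal (k u) * h u \<partial>lborel)"
    if "h \<in> borel_measurable borel" for h
    unfolding k_def by (rule nn_integral_beta_law_1[OF z that])
  have int_f: "integral\<^sup>N (beta_law (z + 1) (z + 1)) h = (\<integral>\<^sup>+ x. ennreal (f x) * h x \<partial>lborel)"
    if "h \<in> borel_measurable borel" for h
    unfolding nn_integral_beta_law[OF that] f_def \<beta>_def by (intro nn_integral_cong) auto
  have kernel_left: "ennreal (f x) * (\<integral>\<^sup>+ u. ennreal (k u) * g ((1 - u / 2) * x) \<partial>lborel) =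
      (\<integral>\<^sup>+ y. ennreal (q y (2 * y - x)) * g y \<partial>lborel)" for x
  proof (cases "0 < x \<and> x < 1")
    case True
    have q_eq: "f x * (2 / x * k (2 + - 2 / x * y)) = q y (2 * y - x)" for y
    proof (cases "x < 2 * y \<and> y < x")
      case y: True
      then have "1 - (2 + - 2 / x * y) = (2 * y - x) / x"
        using True by (simp add: field_simps)
      \<comment> \<open>Splitting off one factor x cancels the x in the Jacobian 2 / x; the
        remaining power cancels the denominator of (2 y - x) / x.\<close>
      moreover have "x powr z = x * x powr (z - 1)"
        using True powr_mult_base[of x "z - 1"] by simp
      moreover have "0 < 2 + - 2 / x * y" "2 + - 2 / x * y < 1"
        using True y by (auto simp: field_simps)
      ultimately show ?thesis
        using True y by (simp add: f_def k_def q_def P_def powr_divide)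
    next
      case False
      then have "\<not> (0 < 2 + - 2 / x * y \<and> 2 + - 2 / x * y < 1)"
        using True by (auto simp: field_simps)
      with False show ?thesis
        by (auto simp: k_def q_def P_def)
    qed
    have "ennreal (f x) * (\<integral>\<^sup>+ u. ennreal (k u) * g ((1 - u / 2) * x) \<partial>lborel) =
      ennreal (f x) * (ennreal (2 / x) * (\<integral>\<^sup>+ y. ennreal (k (2 + - 2 / x * y)) * g ((1 - (2 + - 2 / x * y) / 2) * x) \<partial>lborel))"
      using True by (subst nn_integral_real_affine[where c = "- 2 / x" and t = 2]) auto
    also have "\<dots> = (\<integral>\<^sup>+ y. ennreal (f x) * (ennreal (2 / x) * (ennreal (k (2 + - 2 / x * y)) * g ((1 - (2 + - 2 / x * y) / 2) * x))) \<partial>lborel)"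
      by (subst nn_integral_cmult[symmetric], measurable)+
    also have "\<dots> = (\<integral>\<^sup>+ y. ennreal (q y (2 * y - x)) * g y \<partial>lborel)"
    proof (rule nn_integral_cong)
      fix y
      have "(1 - (2 + - 2 / x * y) / 2) * x = y" using True by (simp add: field_simps)
      then show "ennreal (f x) * (ennreal (2 / x) * (ennreal (k (2 + - 2 / x * y)) * g ((1 - (2 + - 2 / x * y) / 2) * x))) =
          ennreal (q y (2 * y - x)) * g y"
        unfolding q_eq[symmetric] using True
        by (simp only: ennreal_mult nonneg mult.assoc divide_nonneg_pos mult_nonneg_nonneg zero_le_numeral)
    qed
    finally show ?thesis .
  next
    case False
    then have "f x = 0" "q y (2 * y - x) = 0" for y
      by (auto simp: f_def q_def P_def)
    then show ?thesis by simp
  qed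
  have kernel_right: "ennreal (f x) * (\<integral>\<^sup>+ u. ennreal (k u) * g (x + u / 2 * (1 - x)) \<partial>lborel) =
      (\<integral>\<^sup>+ y. ennreal (q' y x) * g y \<partial>lborel)" for x
  proof (cases "0 < x \<and> x < 1")
    case True
    let ?u = "\<lambda>y. - 2 * x / (1 - x) + 2 / (1 - x) * y"
    have u_eq: "?u y = 2 * (y - x) / (1 - x)" for y
      by (simp add: diff_divide_distrib right_diff_distrib)
    have q_eq: "f x * (2 / (1 - x) * k (?u y)) = q' y x" for y
    proof (cases "2 * y - 1 < x \<and> x < y")
      case y: True
      then have "1 - ?u y = (1 - 2 * y + x) / (1 - x)"
        using True unfolding u_eq by (simp add: field_simps)
      \<comment> \<open>As for the other kernel, one factor 1 - x is split off to cancel the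
        denominator of the Jacobian 2 / (1 - x).\<close>
      moreover have "(1 - x) powr z = (1 - x) * (1 - x) powr (z - 1)"
        using True powr_mult_base[of "1 - x" "z - 1"] by simp
      moreover have "0 < ?u y" "?u y < 1"
        using True y unfolding u_eq by (auto simp: field_simps)
      ultimately show ?thesis
        using True y by (simp add: f_def k_def q'_def P_def powr_divide)
    next
      case False
      then have "\<not> (0 < ?u y \<and> ?u y < 1)"
        using True unfolding u_eq by (auto simp: field_simps)
      with False show ?thesis
        by (auto simp: k_def q'_def P_def)
    qed
    have "ennreal (f x) * (\<integral>\<^sup>+ u. ennreal (k u) * g (x + u / 2 * (1 - x)) \<partial>lborel) =
      ennreal (f x) * (ennreal (2 / (1 - x)) * (\<integral>\<^sup>+ y. ennreal (k (?u y)) * g (x + ?u y / 2 * (1 - x)) \<partial>lborel))"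
      using True by (subst nn_integral_real_affine[where c = "2 / (1 - x)" and t = "- 2 * x / (1 - x)"]) auto
    also have "\<dots> = (\<integral>\<^sup>+ y. ennreal (f x) * (ennreal (2 / (1 - x)) * (ennreal (k (?u y)) * g (x + ?u y / 2 * (1 - x)))) \<partial>lborel)"
      by (subst nn_integral_cmult[symmetric], measurable)+
    also have "\<dots> = (\<integral>\<^sup>+ y. ennreal (q' y x) * g y \<partial>lborel)"
    proof (rule nn_integral_cong)
      fix y
      have "2 * c / d / 2 = c / d" for c d :: real by simp
      then have "?u y / 2 = (y - x) / (1 - x)" unfolding u_eq .
      then have "x + ?u y / 2 * (1 - x) = x + (y - x) / (1 - x) * (1 - x)" by (simp only:)
      also have "\<dots> = y" using True by simp
      finally have "x + ?u y / 2 * (1 - x) = y" .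
      then show "ennreal (f x) * (ennreal (2 / (1 - x)) * (ennreal (k (?u y)) * g (x + ?u y / 2 * (1 - x)))) =
          ennreal (q' y x) * g y"
        unfolding q_eq[symmetric] using True
        by (simp only: ennreal_mult nonneg mult.assoc divide_nonneg_pos diff_gt_0_iff_gt
            mult_nonneg_nonneg zero_le_numeral)
    qed
    finally show ?thesis .
  next
    case False
    then have "f x = 0" "q' y x = 0" for y
      by (auto simp: f_def q'_def P_def)
    then show ?thesis by simp
  qed
  \<comment> \<open>The substitution w = 2 y - x preserves Lebesgue measure and puts both kernels
    over the same variable w.\<close>
  have reflect: "(\<integral>\<^sup>+ x. ennreal (q y (2 * y - x)) \<partial>lborel) = (\<integral>\<^sup>+ w. ennreal (q y w) \<partial>lborel)" for y
    by (subst (2) nn_integral_real_affine[where c = "- 1" and t = "2 * y"]) auto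
  \<comment> \<open>\<open>q + q'\<close> is 2 / \<beta> times the derivative integrated in
    \<open>nn_integral_sandwiched_product_derivative\<close>.\<close>
  have total: "(\<integral>\<^sup>+ w. ennreal (q y w) \<partial>lborel) + (\<integral>\<^sup>+ w. ennreal (q' y w) \<partial>lborel) = 2 * ennreal (f y)" for y
  proof -
    have "(\<integral>\<^sup>+ w. ennreal (q y w) \<partial>lborel) + (\<integral>\<^sup>+ w. ennreal (q' y w) \<partial>lborel) =
        (\<integral>\<^sup>+ w. ennreal (q y w) + ennreal (q' y w) \<partial>lborel)"
      by (rule nn_integral_add[symmetric]) measurable
    also have "\<dots> = (\<integral>\<^sup>+ w. ennreal (2 / \<beta>) * ennreal (if P y w
        then z * w powr (z - 1) * (1 - 2 * y + w) powr z + z * w powr z * (1 - 2 * y + w) powr (z - 1)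
        else 0) \<partial>lborel)"
      using z \<beta>
      by (intro nn_integral_cong)
         (simp add: q_def q'_def ennreal_plus[symmetric] ennreal_mult[symmetric] add_divide_distrib
            distrib_left mult.assoc del: ennreal_plus)
    also have "\<dots> = ennreal (2 / \<beta>) * ennreal (if 0 < y \<and> y < 1 then y powr z * (1 - y) powr z else 0)"
      unfolding nn_integral_sandwiched_product_derivative[OF z, symmetric] P_def
      by (rule nn_integral_cmult) measurable
    also have "\<dots> = ennreal (2 * f y)"
      using \<beta> by (simp add: f_def ennreal_mult[symmetric])
    also have "\<dots> = 2 * ennreal (f y)"
      by (simp add: ennreal_mult nonneg)
    finally show ?thesis .
  qed
  have "(\<integral>\<^sup>+ x. \<integral>\<^sup>+ u. g ((1 - u / 2) * x) + g (x + u / 2 * (1 - x)) \<partial>beta_law 1 z \<partial>beta_law (z + 1) (z + 1)) =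
      (\<integral>\<^sup>+ x. ennreal (f x) * ((\<integral>\<^sup>+ u. ennreal (k u) * g ((1 - u / 2) * x) \<partial>lborel) +
        (\<integral>\<^sup>+ u. ennreal (k u) * g (x + u / 2 * (1 - x)) \<partial>lborel)) \<partial>lborel)"
    by (simp add: int_k int_f nn_integral_add distrib_left)
  also have "\<dots> = (\<integral>\<^sup>+ x. (\<integral>\<^sup>+ y. ennreal (q y (2 * y - x)) * g y \<partial>lborel) +
      (\<integral>\<^sup>+ y. ennreal (q' y x) * g y \<partial>lborel) \<partial>lborel)"
    by (simp only: distrib_left kernel_left kernel_right)
  also have "\<dots> = (\<integral>\<^sup>+ x. (\<integral>\<^sup>+ y. ennreal (q y (2 * y - x)) * g y \<partial>lborel) \<partial>lborel) +
      (\<integral>\<^sup>+ x. (\<integral>\<^sup>+ y. ennreal (q' y x) * g y \<partial>lborel) \<partial>lborel)"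
    by (rule nn_integral_add) measurable
  \<comment> \<open>Integrating over x first isolates the coefficient of \<open>g y\<close>, which
    is then found from \<open>total\<close>.\<close>
  also have "\<dots> = (\<integral>\<^sup>+ y. (\<integral>\<^sup>+ x. ennreal (q y (2 * y - x)) * g y \<partial>lborel) \<partial>lborel) +
      (\<integral>\<^sup>+ y. (\<integral>\<^sup>+ x. ennreal (q' y x) * g y \<partial>lborel) \<partial>lborel)"
    by (intro arg_cong2[where f = plus] lborel_pair.Fubini') measurable
  also have "\<dots> = (\<integral>\<^sup>+ y. (\<integral>\<^sup>+ w. ennreal (q y w) \<partial>lborel) * g y + (\<integral>\<^sup>+ w. ennreal (q' y w) \<partial>lborel) * g y \<partial>lborel)"
    by (simp add: nn_integral_multc reflect nn_integral_add)
  also have "\<dots> = (\<integral>\<^sup>+ y. 2 * (ennreal (f y) * g y) \<partial>lborel)"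
    by (simp only: distrib_right[symmetric] total mult.assoc)
  also have "\<dots> = 2 * (\<integral>\<^sup>+ y. g y \<partial>beta_law (z + 1) (z + 1))"
    by (simp add: int_f nn_integral_cmult)
  finally show ?thesis .
qed

subsection \<open>Random affine maps\<close>

lemma borel_measurable_lipschitz_on:
  fixes f :: "'a::metric_space \<Rightarrow> 'b::metric_space"
  assumes "k-lipschitz_on UNIV f"
  shows "f \<in> borel_measurable borel"
  using lipschitz_on_continuous_on[OF assms] by (rule borel_measurable_continuous_onI)

text \<open>A unimodular factor can be pulled out, and |exp (i s) - 1| \<le> |s|. Characteristic
  functions thus become integrals of bounded Lipschitz test functions.\<close>

lemma iexp_lipschitz: "\<bar>t\<bar>-lipschitz_on UNIV (\<lambda>x. iexp (t * x))"
proof (rule lipschitz_onI)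
  fix x y :: real
  have "iexp (t * x) - iexp (t * y) = iexp (t * y) * (iexp (t * (x - y)) - 1)"
    by (simp add: algebra_simps exp_add[symmetric])
  moreover have "norm (iexp (t * (x - y)) - 1) \<le> \<bar>t * (x - y)\<bar>"
    using iexp_approx1[of "t * (x - y)" 0] by simp
  ultimately show "dist (iexp (t * x)) (iexp (t * y)) \<le> \<bar>t\<bar> * dist x y"
    by (simp add: dist_norm norm_mult abs_mult)
qed auto

text \<open>One step of the chain, used twice below: A x + B (1 - x) = (A - B) x + B gives C = A - B
  and D = B, and A x + B V gives C = A and D = B V. \<open>C\<close> and \<open>D\<close> may depend
  on each other.\<close>

locale random_affine_map = prob_space K for K :: "'w measure" +
  fixes C D :: "'w \<Rightarrow> real"
  assumes C_measurable [measurable]: "C \<in> borel_measurable K"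
    and D_measurable [measurable]: "D \<in> borel_measurable K"
    and C_bounds: "AE w in K. 0 \<le> C w \<and> C w \<le> 1"
    and C_nontrivial: "\<not> (AE w in K. C w = 1)"
begin

text \<open>The Markov operator of the chain; its powers describe expectations after several
  steps.\<close>

definition transfer :: "(real \<Rightarrow> complex) \<Rightarrow> real \<Rightarrow> complex" where
  "transfer f x = (\<integral>w. f (C w * x + D w) \<partial>K)"

definition stationary :: "real measure \<Rightarrow> bool" where
  "stationary \<nu> \<longleftrightarrow> prob_space \<nu> \<and> sets \<nu> = sets borel \<and>
     \<nu> = distr (\<nu> \<Otimes>\<^sub>M K) borel (\<lambda>(x, w). C w * x + D w)"

lemma integrable_C: "integrable K C"
  using C_bounds by (intro integrable_const_bound[of _ 1]) auto

text \<open>Equality E C = 1 would make the integral of the nonnegative 1 - C vanish, so C = 1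
  almost surely, against \<open>C_nontrivial\<close>.\<close>

lemma expectation_C: "0 \<le> expectation C" "expectation C < 1"
proof -
  show "0 \<le> expectation C"
    using C_bounds by (intro integral_nonneg_AE) auto
  have "expectation C \<le> expectation (\<lambda>_. 1)"
    using C_bounds by (intro integral_mono_AE integrable_C) auto
  moreover have "expectation C \<noteq> 1"
  proof
    assume "expectation C = 1"
    then have "expectation (\<lambda>w. 1 - C w) = 0"
      using integrable_C by (simp add: prob_space)
    then have "AE w in K. 1 - C w = 0"
      using C_bounds integrable_C
      by (subst (asm) integral_nonneg_eq_0_iff_AE) auto
    then show False using C_nontrivial by simp
  qed
  ultimately show "expectation C < 1" by (simp add: prob_space)
qed

lemma norm_transfer_le:
  assumes "\<And>x. norm (f x) \<le> 1"
  shows "norm (transfer f x) \<le> 1"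
proof -
  have "norm (transfer f x) \<le> (\<integral>w. norm (f (C w * x + D w)) \<partial>K)"
    unfolding transfer_def by (rule integral_norm_bound)
  \<comment> \<open>A non-integrable function has Bochner integral 0, so the bound is also valid
    when \<open>f\<close> is not measurable.\<close>
  also have "\<dots> \<le> (\<integral>w. 1 \<partial>K)"
    using assms by (intro integral_mono') auto
  finally show ?thesis by (simp add: prob_space)
qed

text \<open>Move x and y by the same random map: D cancels and the distance is multiplied by C.
  Taking expectations gives the factor E C.\<close>

lemma lipschitz_transfer:
  assumes lip: "k-lipschitz_on UNIV f" and bnd: "\<And>x. norm (f x) \<le> 1"
  shows "(expectation C * k)-lipschitz_on UNIV (transfer f)"
proof (rule lipschitz_onI)
  note [measurable] = borel_measurable_lipschitz_on[OF lip]
  have k: "k \<ge> 0" using lip by (rule lipschitz_on_nonneg)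
  then show "0 \<le> expectation C * k" by (simp add: expectation_C)
  fix x y :: real
  have int: "integrable K (\<lambda>w. f (C w * x + D w))" for x
    using bnd by (intro integrable_const_bound[of _ 1]) auto
  have "dist (transfer f x) (transfer f y) =
      norm (\<integral>w. f (C w * x + D w) - f (C w * y + D w) \<partial>K)"
    by (simp add: transfer_def dist_norm int)
  also have "\<dots> \<le> (\<integral>w. norm (f (C w * x + D w) - f (C w * y + D w)) \<partial>K)"
    by (rule integral_norm_bound)
  also have "\<dots> \<le> (\<integral>w. C w * (k * dist x y) \<partial>K)"
  proof (rule integral_mono_AE)
    show "AE w in K. norm (f (C w * x + D w) - f (C w * y + D w)) \<le> C w * (k * dist x y)"
      using C_bounds
    proof eventually_elim
      case (elim w)
      have "norm (f (C w * x + D w) - f (C w * y + D w)) \<le> k * dist (C w * x + D w) (C w * y + D w)"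
        using lipschitz_onD[OF lip, of "C w * x + D w" "C w * y + D w"] by (simp add: dist_norm)
      also have "dist (C w * x + D w) (C w * y + D w) = C w * dist x y"
        using elim by (simp add: dist_real_def right_diff_distrib[symmetric] abs_mult)
      finally show ?case by (simp add: mult_ac)
    qed
  qed (auto intro!: integrable_norm Bochner_Integration.integrable_diff int integrable_C)
  also have "\<dots> = expectation C * k * dist x y"
    by simp
  finally show "dist (transfer f x) (transfer f y) \<le> expectation C * k * dist x y" .
qed

section \<open>Iterated contraction and uniqueness of the stationary law\<close>

lemma transfer_funpow:
  assumes lip: "k-lipschitz_on UNIV f" and bnd: "\<And>x. norm (f x) \<le> 1"
  shows "(expectation C ^ n * k)-lipschitz_on UNIV ((transfer ^^ n) f)" "norm ((transfer ^^ n) f x) \<le> 1"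
proof (induction n arbitrary: x)
  case (Suc n)
  { case 1 show ?case using lipschitz_transfer[OF Suc] by (simp add: mult.assoc) }
  { case 2 show ?case using norm_transfer_le[OF Suc(2)] by simp }
qed (use assms in auto)

text \<open>By invariance and Fubini, one application of \<open>transfer\<close> to a bounded
  measurable function preserves its integral. The iterates qualify because they stay Lipschitz and
  bounded by 1.\<close>

lemma integral_stationary:
  assumes st: "stationary \<nu>" and lip: "k-lipschitz_on UNIV f" and bnd: "\<And>x. norm (f x) \<le> 1"
  shows "(\<integral>x. (transfer ^^ n) f x \<partial>\<nu>) = (\<integral>x. f x \<partial>\<nu>)"
proof (induction n)
  case (Suc n)
  interpret \<nu>: prob_space \<nu> using st by (simp add: stationary_def)
  interpret P: pair_prob_space \<nu> K ..
  have [measurable_cong]: "sets \<nu> = sets borel" using st by (simp add: stationary_def)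
  define g where "g = (transfer ^^ n) f"
  have [measurable]: "g \<in> borel_measurable borel"
    unfolding g_def by (rule borel_measurable_lipschitz_on[OF transfer_funpow(1)[OF lip bnd]])
  have "norm (g x) \<le> 1" for x
    unfolding g_def by (rule transfer_funpow(2)[OF lip bnd])
  have "(\<integral>x. g x \<partial>\<nu>) = (\<integral>x. g x \<partial>distr (\<nu> \<Otimes>\<^sub>M K) borel (\<lambda>(x, w). C w * x + D w))"
    using st by (simp add: stationary_def)
  also have "\<dots> = (\<integral>p. (case p of (x, w) \<Rightarrow> g (C w * x + D w)) \<partial>(\<nu> \<Otimes>\<^sub>M K))"
    by (subst integral_distr) (auto simp: case_prod_unfold)
  also have "\<dots> = (\<integral>x. transfer g x \<partial>\<nu>)"
    unfolding transfer_def
  proof (rule P.integral_fst'[symmetric, of "\<lambda>p. case p of (x, w) \<Rightarrow> g (C w * x + D w)", simplified])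
    show "integrable (\<nu> \<Otimes>\<^sub>M K) (\<lambda>(x, w). g (C w * x + D w))"
      using \<open>\<And>x. norm (g x) \<le> 1\<close>
      by (intro P.P.integrable_const_bound[of _ 1]) auto
  qed
  finally show ?case using Suc by (simp add: g_def)
qed simp

text \<open>By stationarity the error is the \<nu>-integral over y of the difference of the n-th
  iterates at x and y. That difference is at most (E C)^n k |x - y|, hence tends to 0 for each y,
  and is at most 2. Dominated convergence with the constant 2 takes the place of a moment of
  \<nu>.\<close>

lemma transfer_funpow_tendsto:
  assumes st: "stationary \<nu>" and lip: "k-lipschitz_on UNIV f" and bnd: "\<And>x. norm (f x) \<le> 1"
  shows "(\<lambda>n. (transfer ^^ n) f x) \<longlonglongrightarrow> (\<integral>y. f y \<partial>\<nu>)"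
proof -
  interpret \<nu>: prob_space \<nu> using st by (simp add: stationary_def)
  have [measurable_cong]: "sets \<nu> = sets borel" using st by (simp add: stationary_def)
  note T = transfer_funpow[OF lip bnd]
  note [measurable] = borel_measurable_lipschitz_on[OF T(1)]
  have "(\<lambda>n. \<integral>y. (transfer ^^ n) f x - (transfer ^^ n) f y \<partial>\<nu>) \<longlonglongrightarrow> (\<integral>y. 0 \<partial>\<nu>)"
  proof (rule integral_dominated_convergence[where w = "\<lambda>_. 2"])
    show "AE y in \<nu>. norm ((transfer ^^ n) f x - (transfer ^^ n) f y) \<le> 2" for n
    proof (rule AE_I2)
      fix y
      show "norm ((transfer ^^ n) f x - (transfer ^^ n) f y) \<le> 2"
        using norm_triangle_ineq4[of "(transfer ^^ n) f x" "(transfer ^^ n) f y"] T(2)[of n x] T(2)[of n y]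
        by linarith
    qed
    show "AE y in \<nu>. (\<lambda>n. (transfer ^^ n) f x - (transfer ^^ n) f y) \<longlonglongrightarrow> 0"
    proof (rule AE_I2)
      fix y
      have "(\<lambda>n. expectation C ^ n * k * dist x y) \<longlonglongrightarrow> 0 * k * dist x y"
        using expectation_C by (intro tendsto_intros LIMSEQ_power_zero) auto
      then have "(\<lambda>n. expectation C ^ n * k * dist x y) \<longlonglongrightarrow> 0" by simp
      then show "(\<lambda>n. (transfer ^^ n) f x - (transfer ^^ n) f y) \<longlonglongrightarrow> 0"
        by (rule Lim_null_comparison[rotated])
           (use lipschitz_onD[OF T(1)] in \<open>auto simp: dist_norm\<close>)
    qed
  qed auto
  moreover have "(\<integral>y. (transfer ^^ n) f x - (transfer ^^ n) f y \<partial>\<nu>) = (transfer ^^ n) f x - (\<integral>y. f y \<partial>\<nu>)" for n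
    using T(2) \<nu>.integrable_const_bound[of "(transfer ^^ n) f" 1]
    by (subst Bochner_Integration.integral_diff)
       (auto simp: integral_stationary[OF st lip bnd] \<nu>.prob_space)
  ultimately show ?thesis
    by (simp add: LIM_zero_iff)
qed

lemma char_tendsto:
  assumes "stationary \<nu>"
  shows "(\<lambda>n. (transfer ^^ n) (\<lambda>x. iexp (t * x)) x) \<longlonglongrightarrow> char \<nu> t"
  unfolding char_def using assms iexp_lipschitz by (rule transfer_funpow_tendsto) simp

lemma real_distribution_stationary: "stationary \<nu> \<Longrightarrow> real_distribution \<nu>"
  using sets_eq_imp_space_eq[of \<nu> borel]
  by (simp add: stationary_def real_distribution_def real_distribution_axioms_def)

text \<open>The sequence in \<open>char_tendsto\<close> does not involve the stationary law, so any
  two such laws have the same characteristic function.\<close>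

lemma stationary_unique:
  assumes st: "stationary \<nu>" and st': "stationary \<nu>'"
  shows "\<nu>' = \<nu>"
proof (rule Levy_uniqueness)
  show "real_distribution \<nu>" "real_distribution \<nu>'" using st st' by (simp_all add: real_distribution_stationary)
  show "char \<nu>' = char \<nu>"
    using LIMSEQ_unique[OF char_tendsto[OF st'] char_tendsto[OF st]] by auto
qed

end

subsection \<open>Iterations of random affine maps\<close>

lemma forward_iter_cong:
  "(\<And>i. i \<in> {1..n} \<Longrightarrow> f i = g i) \<Longrightarrow> forward_iter f n = forward_iter g n"
  by (induction n) auto

lemma backward_iter_cong:
  "(\<And>i. i \<in> {1..n} \<Longrightarrow> f i = g i) \<Longrightarrow> backward_iter f n = backward_iter g n"
  by (induction n) auto

text \<open>Backward iterates append new maps on the inside, and these keep \<open>S\<close>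
  invariant; the images of \<open>S\<close> are therefore nested.\<close>

lemma backward_iter_factor:
  assumes "\<And>i x. i \<ge> 1 \<Longrightarrow> x \<in> S \<Longrightarrow> f i x \<in> S" and "n \<le> m" and "x \<in> S"
  shows "\<exists>y\<in>S. backward_iter f m x = backward_iter f n y"
  using assms(2,3)
proof (induction m arbitrary: x rule: dec_induct)
  case (step m)
  then show ?case using assms(1)[of "Suc m" x] by auto
qed auto

text \<open>For n \<le> m the m-th iterate of x0 lies in the n-th image of \<open>S\<close>, whose
  diameter is at most \<open>P n\<close>. This makes the sequence Cauchy and bounds the distance of
  the n-th iterate from the limit uniformly on \<open>S\<close>.\<close>

lemma uniform_limit_backward_iter:
  fixes f :: "nat \<Rightarrow> real \<Rightarrow> real"
  assumes maps: "\<And>i x. i \<ge> 1 \<Longrightarrow> x \<in> S \<Longrightarrow> f i x \<in> S"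
    and diam: "\<And>n x y. x \<in> S \<Longrightarrow> y \<in> S \<Longrightarrow> dist (backward_iter f n x) (backward_iter f n y) \<le> P n"
    and P: "P \<longlonglongrightarrow> 0" and "x0 \<in> S"
  shows "uniform_limit S (backward_iter f) (\<lambda>_. lim (\<lambda>n. backward_iter f n x0)) sequentially"
    and "convergent (\<lambda>n. backward_iter f n x0)"
proof -
  have close: "dist (backward_iter f n x) (backward_iter f m x0) \<le> P n" if "n \<le> m" "x \<in> S" for n m x
  proof -
    obtain y where "y \<in> S" "backward_iter f m x0 = backward_iter f n y"
      using backward_iter_factor[of S f n m x0, OF maps \<open>n \<le> m\<close> \<open>x0 \<in> S\<close>] by blast
    then show ?thesis using diam that by auto
  qed
  show conv: "convergent (\<lambda>n. backward_iter f n x0)"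
  proof (rule Cauchy_convergent, rule metric_CauchyI)
    fix e :: real assume "e > 0"
    then have "e / 2 > 0" by simp
    then have "\<forall>\<^sub>F n in sequentially. P n < e / 2" using P by (rule order_tendstoD(2)[rotated])
    then obtain N where N: "P N < e / 2" by (auto simp: eventually_sequentially)
    show "\<exists>N. \<forall>m\<ge>N. \<forall>n\<ge>N. dist (backward_iter f m x0) (backward_iter f n x0) < e"
    proof (intro exI[of _ N] allI impI)
      fix m n assume "N \<le> m" "N \<le> n"
      then have "dist (backward_iter f N x0) (backward_iter f m x0) \<le> P N"
        "dist (backward_iter f N x0) (backward_iter f n x0) \<le> P N"
        using close \<open>x0 \<in> S\<close> by auto
      then show "dist (backward_iter f m x0) (backward_iter f n x0) < e"
        using N dist_triangle3[of "backward_iter f m x0" "backward_iter f n x0" "backward_iter f N x0"]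
        by linarith
    qed
  qed
  let ?Y = "lim (\<lambda>n. backward_iter f n x0)"
  have lim: "(\<lambda>n. backward_iter f n x0) \<longlonglongrightarrow> ?Y"
    using conv by (simp add: convergent_LIMSEQ_iff)
  have bound: "dist (backward_iter f n x) ?Y \<le> P n" if "x \<in> S" for n x
  proof (rule LIMSEQ_le_const2)
    show "(\<lambda>m. dist (backward_iter f n x) (backward_iter f m x0)) \<longlonglongrightarrow> dist (backward_iter f n x) ?Y"
      by (intro tendsto_intros lim)
    show "\<exists>N. \<forall>m\<ge>N. dist (backward_iter f n x) (backward_iter f m x0) \<le> P n"
      using close[OF _ that] by blast
  qed
  show "uniform_limit S (backward_iter f) (\<lambda>_. ?Y) sequentially"
  proof (rule uniform_limitI)
    fix e :: real assume "e > 0"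
    then have "\<forall>\<^sub>F n in sequentially. P n < e" using P by (rule order_tendstoD(2)[rotated])
    then show "\<forall>\<^sub>F n in sequentially. \<forall>x\<in>S. dist (backward_iter f n x) ?Y < e"
    proof eventually_elim
      case (elim n)
      then show ?case using bound[of _ n] by (auto intro: le_less_trans)
    qed
  qed
qed

text \<open>\<open>K\<close> is both the space on which \<open>C\<close> and \<open>D\<close> live
  and the law of each \<open>W n\<close>, so every \<open>W n\<close> samples one affine
  map.\<close>

locale iid_affine_maps = random_affine_map K C D + M: prob_space M
  for K :: "'w measure" and C D and M :: "'m measure" +
  fixes W :: "nat \<Rightarrow> 'm \<Rightarrow> 'w"
  assumes W_indep: "M.indep_vars (\<lambda>_. K) W {1..}"
    and W_distr: "\<And>n. n \<ge> 1 \<Longrightarrow> distr M K (W n) = K"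
begin

declare One_nat_def [simp del]

definition affine :: "(nat \<Rightarrow> 'w) \<Rightarrow> nat \<Rightarrow> real \<Rightarrow> real" where
  "affine s n x = C (s n) * x + D (s n)"

section \<open>Joint laws of the first maps, and measurability of the iterates\<close>

abbreviation past :: "nat \<Rightarrow> (nat \<Rightarrow> 'w) measure" where
  "past n \<equiv> distr M (PiM {1..n} (\<lambda>_. K)) (\<lambda>\<omega>. restrict (\<lambda>i. W i \<omega>) {1..n})"

lemma W_measurable: "n \<ge> 1 \<Longrightarrow> W n \<in> M \<rightarrow>\<^sub>M K"
  using W_indep by (auto simp: M.indep_vars_def)

lemma past_measurable [measurable]:
  "(\<lambda>\<omega>. restrict (\<lambda>i. W i \<omega>) {1..n}) \<in> M \<rightarrow>\<^sub>M PiM {1..n} (\<lambda>_. K)"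
  by (rule measurable_restrict) (simp add: W_measurable)

lemma prob_space_past: "prob_space (past n)"
  by (rule M.prob_space_distr) measurable

text \<open>Grouping an independent family makes the blocks {1..n} and {n + 1} independent. The
  second block is a product over one index and is projected to its single coordinate.\<close>

lemma past_pair:
  "distr M (PiM {1..n} (\<lambda>_. K) \<Otimes>\<^sub>M K) (\<lambda>\<omega>. (restrict (\<lambda>i. W i \<omega>) {1..n}, W (Suc n) \<omega>)) = past n \<Otimes>\<^sub>M K"
proof -
  let ?X = "\<lambda>\<omega>. restrict (\<lambda>i. W i \<omega>) {1..n}" and ?X' = "\<lambda>\<omega>. restrict (\<lambda>i. W i \<omega>) {Suc n}"
  let ?P = "PiM {1..n} (\<lambda>_. K)" and ?P' = "PiM {Suc n} (\<lambda>_. K)"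
  have ind: "M.indep_var ?P ?X ?P' ?X'"
    by (rule M.indep_var_restrict[OF W_indep]) auto
  have [measurable]: "?X' \<in> M \<rightarrow>\<^sub>M ?P'"
    using ind by (rule M.indep_var_rv2)
  have W': "distr (distr M ?P' ?X') K (\<lambda>s. s (Suc n)) = K"
    using W_distr[of "Suc n"] by (subst distr_distr) (auto simp: comp_def)
  have "past n \<Otimes>\<^sub>M K = distr (past n) ?P (\<lambda>s. s) \<Otimes>\<^sub>M distr (distr M ?P' ?X') K (\<lambda>s. s (Suc n))"
    unfolding W' by (simp add: distr_id2)
  also have "\<dots> = distr (past n \<Otimes>\<^sub>M distr M ?P' ?X') (?P \<Otimes>\<^sub>M K) (\<lambda>(s, t). (s, t (Suc n)))"
    by (rule pair_measure_distr) (auto simp: W' sigma_finite_measure_axioms)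
  also have "past n \<Otimes>\<^sub>M distr M ?P' ?X' = distr M (?P \<Otimes>\<^sub>M ?P') (\<lambda>\<omega>. (?X \<omega>, ?X' \<omega>))"
    using ind unfolding M.indep_var_distribution_eq by blast
  also have "distr \<dots> (?P \<Otimes>\<^sub>M K) (\<lambda>(s, t). (s, t (Suc n))) =
      distr M (?P \<Otimes>\<^sub>M K) (\<lambda>\<omega>. (?X \<omega>, W (Suc n) \<omega>))"
    by (subst distr_distr) (auto simp: comp_def)
  finally show ?thesis ..
qed

lemma affine_measurable [measurable (raw)]:
  assumes "i \<in> {1..m}" "g \<in> N \<rightarrow>\<^sub>M PiM {1..m} (\<lambda>_. K)" "h \<in> borel_measurable N"
  shows "(\<lambda>p. affine (g p) i (h p)) \<in> borel_measurable N"
proof -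
  have "(\<lambda>p. g p i) \<in> N \<rightarrow>\<^sub>M K"
    using assms(2) measurable_component_singleton[OF assms(1)] by (rule measurable_compose)
  then show ?thesis
    unfolding affine_def using assms(3) by measurable
qed

lemma forward_measurable:
  "n \<le> m \<Longrightarrow> g \<in> N \<rightarrow>\<^sub>M PiM {1..m} (\<lambda>_. K) \<Longrightarrow> h \<in> borel_measurable N \<Longrightarrow>
    (\<lambda>p. forward_iter (affine (g p)) n (h p)) \<in> borel_measurable N"
  by (induction n) (auto intro!: affine_measurable)

lemma backward_measurable:
  "n \<le> m \<Longrightarrow> g \<in> N \<rightarrow>\<^sub>M PiM {1..m} (\<lambda>_. K) \<Longrightarrow> h \<in> borel_measurable N \<Longrightarrow>
    (\<lambda>p. backward_iter (affine (g p)) n (h p)) \<in> borel_measurable N"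
\<comment> \<open>The newest map is innermost and changes the starting point, so \<open>h\<close>
  has to vary.\<close>
proof (induction n arbitrary: h)
  case (Suc n)
  then have "(\<lambda>p. affine (g p) (Suc n) (h p)) \<in> borel_measurable N"
    by (intro affine_measurable) auto
  with Suc show ?case by simp
qed simp

lemma forward_restrict:
  "forward_iter (affine (restrict s {1..n})) n = forward_iter (affine s) n"
  by (rule forward_iter_cong) (auto simp: affine_def)

lemma backward_restrict:
  "backward_iter (affine (restrict s {1..n})) n = backward_iter (affine s) n"
  by (rule backward_iter_cong) (auto simp: affine_def)

lemma forward_random_variable [measurable]:
  "(\<lambda>\<omega>. forward_iter (affine (\<lambda>i. W i \<omega>)) n x) \<in> borel_measurable M"
  using forward_measurable[OF order_refl past_measurable[of n] measurable_const[of x]]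
  by (simp add: forward_restrict)

lemma backward_random_variable [measurable]:
  "(\<lambda>\<omega>. backward_iter (affine (\<lambda>i. W i \<omega>)) n x) \<in> borel_measurable M"
  using backward_measurable[OF order_refl past_measurable[of n] measurable_const[of x]]
  by (simp add: backward_restrict)

text \<open>Both orders of Fubini are recorded: averaging the newest map first suits forward
  iteration, averaging the past first suits backward iteration.\<close>

lemma integral_past_pair:
  fixes \<phi> :: "(nat \<Rightarrow> 'w) \<Rightarrow> 'w \<Rightarrow> complex"
  assumes [measurable]: "case_prod \<phi> \<in> borel_measurable (PiM {1..n} (\<lambda>_. K) \<Otimes>\<^sub>M K)"
    and bnd: "\<And>s w. norm (\<phi> s w) \<le> 1"
  shows "(\<integral>\<omega>. \<phi> (restrict (\<lambda>i. W i \<omega>) {1..n}) (W (Suc n) \<omega>) \<partial>M) = (\<integral>s. \<integral>w. \<phi> s w \<partial>K \<partial>past n)"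
    and "(\<integral>\<omega>. \<phi> (restrict (\<lambda>i. W i \<omega>) {1..n}) (W (Suc n) \<omega>) \<partial>M) = (\<integral>w. \<integral>s. \<phi> s w \<partial>past n \<partial>K)"
proof -
  interpret past: prob_space "past n" by (rule prob_space_past)
  interpret P: pair_prob_space "past n" K ..
  note [measurable] = W_measurable[of "Suc n", simplified]
  have int: "integrable (past n \<Otimes>\<^sub>M K) (case_prod \<phi>)"
    using bnd by (intro P.P.integrable_const_bound[of _ 1]) auto
  have "(\<integral>\<omega>. \<phi> (restrict (\<lambda>i. W i \<omega>) {1..n}) (W (Suc n) \<omega>) \<partial>M) = (\<integral>p. case_prod \<phi> p \<partial>(past n \<Otimes>\<^sub>M K))"
    unfolding past_pair[symmetric] by (subst integral_distr) auto
  then show "(\<integral>\<omega>. \<phi> (restrict (\<lambda>i. W i \<omega>) {1..n}) (W (Suc n) \<omega>) \<partial>M) = (\<integral>s. \<integral>w. \<phi> s w \<partial>K \<partial>past n)"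
    "(\<integral>\<omega>. \<phi> (restrict (\<lambda>i. W i \<omega>) {1..n}) (W (Suc n) \<omega>) \<partial>M) = (\<integral>w. \<integral>s. \<phi> s w \<partial>past n \<partial>K)"
    using P.integral_fst'[OF int] P.integral_snd[OF int] by auto
qed

text \<open>The newest map is outermost. Averaging over it replaces \<open>f\<close> by
  \<open>transfer f\<close> at the previous iterate, so the induction runs over all test
  functions.\<close>

lemma integral_forward_iter:
  assumes "k-lipschitz_on UNIV f" and "\<And>x. norm (f x) \<le> 1"
  shows "(\<integral>\<omega>. f (forward_iter (affine (\<lambda>i. W i \<omega>)) n x) \<partial>M) = (transfer ^^ n) f x"
  using assms
proof (induction n arbitrary: f k)
  case 0
  then show ?case by (simp add: M.prob_space)
next
  case (Suc n)
  note [measurable] = borel_measurable_lipschitz_on[OF Suc.prems(1)]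
    borel_measurable_lipschitz_on[OF lipschitz_transfer[OF Suc.prems]]
    forward_measurable[OF order_refl, of _ _ n]
  have "(\<integral>\<omega>. f (forward_iter (affine (\<lambda>i. W i \<omega>)) (Suc n) x) \<partial>M) =
      (\<integral>\<omega>. (\<lambda>s w. f (C w * forward_iter (affine s) n x + D w)) (restrict (\<lambda>i. W i \<omega>) {1..n}) (W (Suc n) \<omega>) \<partial>M)"
    by (simp add: forward_restrict) (simp add: affine_def)
  also have "\<dots> = (\<integral>s. \<integral>w. f (C w * forward_iter (affine s) n x + D w) \<partial>K \<partial>past n)"
    using Suc.prems by (intro integral_past_pair) auto
  also have "\<dots> = (\<integral>\<omega>. transfer f (forward_iter (affine (\<lambda>i. W i \<omega>)) n x) \<partial>M)"
    unfolding transfer_def[symmetric] by (subst integral_distr) (auto simp: forward_restrict)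
  also have "\<dots> = (transfer ^^ Suc n) f x"
    using Suc.IH[OF lipschitz_transfer[OF Suc.prems] norm_transfer_le[OF Suc.prems(2)]]
    by (simp only: funpow_Suc_right comp_apply)
  finally show ?case .
qed

text \<open>The newest map is innermost. Given it, the past acts on a new starting point, so the
  induction keeps \<open>f\<close> and varies x. The result is the same power of
  \<open>transfer\<close> as in the forward case.\<close>

lemma integral_backward_iter:
  assumes lip: "k-lipschitz_on UNIV f" and bnd: "\<And>x. norm (f x) \<le> 1"
  shows "(\<integral>\<omega>. f (backward_iter (affine (\<lambda>i. W i \<omega>)) n x) \<partial>M) = (transfer ^^ n) f x"
proof (induction n arbitrary: x)
  case 0
  then show ?case by (simp add: M.prob_space)
next
  case (Suc n)
  note [measurable] = borel_measurable_lipschitz_on[OF lip] backward_measurable[OF order_refl, of _ _ n]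
  have past: "(\<integral>s. f (backward_iter (affine s) n y) \<partial>past n) = (transfer ^^ n) f y" for y
    unfolding Suc.IH[symmetric] by (subst integral_distr) (auto simp: backward_restrict)
  have "(\<integral>\<omega>. f (backward_iter (affine (\<lambda>i. W i \<omega>)) (Suc n) x) \<partial>M) =
      (\<integral>\<omega>. (\<lambda>s w. f (backward_iter (affine s) n (C w * x + D w))) (restrict (\<lambda>i. W i \<omega>) {1..n}) (W (Suc n) \<omega>) \<partial>M)"
    by (simp add: backward_restrict) (simp add: affine_def)
  also have "\<dots> = (\<integral>w. \<integral>s. f (backward_iter (affine s) n (C w * x + D w)) \<partial>past n \<partial>K)"
    using bnd by (intro integral_past_pair) auto
  also have "\<dots> = (\<integral>w. (transfer ^^ n) f (C w * x + D w) \<partial>K)"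
    by (simp only: past)
  also have "\<dots> = (transfer ^^ Suc n) f x"
    by (simp add: transfer_def)
  finally show ?case .
qed

lemma weak_conv_forward_iter:
  assumes "stationary \<nu>"
  shows "weak_conv_m (\<lambda>n. distr M borel (\<lambda>\<omega>. forward_iter (affine (\<lambda>i. W i \<omega>)) n x)) \<nu>"
proof (rule levy_continuity)
  show "real_distribution \<nu>"
    using assms by (rule real_distribution_stationary)
  show "(\<lambda>n. char (distr M borel (\<lambda>\<omega>. forward_iter (affine (\<lambda>i. W i \<omega>)) n x)) t) \<longlonglongrightarrow> char \<nu> t" for t
    using char_tendsto[OF assms, of t x] integral_forward_iter[OF iexp_lipschitz, of t _ x]
    by (simp add: char_def integral_distr)
qed simp

section \<open>Almost sure convergence of the backward iteration\<close>

lemma backward_iter_diff: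
  "backward_iter (affine s) n x - backward_iter (affine s) n y = (\<Prod>i\<in>{1..n}. C (s i)) * (x - y)"
proof (induction n arbitrary: x y)
  case (Suc n)
  have "affine s (Suc n) x - affine s (Suc n) y = C (s (Suc n)) * (x - y)"
    by (simp add: affine_def right_diff_distrib)
  then show ?case by (simp add: Suc)
qed simp

lemma AE_W: "AE w in K. Q w \<Longrightarrow> AE \<omega> in M. \<forall>i\<ge>1. Q (W i \<omega>)"
  unfolding AE_all_countable
proof
  fix i assume Q: "AE w in K. Q w"
  show "AE \<omega> in M. 1 \<le> i \<longrightarrow> Q (W i \<omega>)"
  proof (cases "1 \<le> i")
    case True
    have "AE w in distr M K (W i). Q w" unfolding W_distr[OF True] by (rule Q)
    from AE_distrD[OF W_measurable[OF True] this] show ?thesis by auto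
  qed simp
qed

text \<open>By independence the n-th product has expectation (E C)^n, which is summable. Hence the
  sum of all products is almost surely finite and its terms tend to 0.\<close>

lemma prod_C_tendsto_0: "AE \<omega> in M. (\<lambda>n. \<Prod>i\<in>{1..n}. C (W i \<omega>)) \<longlonglongrightarrow> 0"
proof -
  define P where "P n \<omega> = (\<Prod>i\<in>{1..n}. C (W i \<omega>))" for n \<omega>
  have [measurable]: "(\<lambda>\<omega>. C (W i \<omega>)) \<in> borel_measurable M" if "i \<ge> 1" for i
    using measurable_compose[OF W_measurable[OF that] C_measurable] .
  have P_measurable [measurable]: "P n \<in> borel_measurable M" for n
    unfolding P_def by (intro borel_measurable_prod) simp
  have EC: "integrable M (\<lambda>\<omega>. C (W i \<omega>))" "(\<integral>\<omega>. C (W i \<omega>) \<partial>M) = expectation C" if "i \<ge> 1" for i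
    using integrable_C integrable_distr[OF W_measurable[OF that], of C]
      integral_distr[OF W_measurable[OF that], of C] by (auto simp: W_distr[OF that])
  have nonneg: "AE \<omega> in M. \<forall>n. 0 \<le> P n \<omega>"
    using AE_W[OF C_bounds] by eventually_elim (auto simp: P_def intro!: prod_nonneg)
  have ind: "M.indep_vars (\<lambda>_. borel) (\<lambda>i \<omega>. C (W i \<omega>)) {1..n}" for n
    by (rule M.indep_vars_compose2[OF M.indep_vars_subset[OF W_indep]]) auto
  have "(\<integral>\<^sup>+ \<omega>. ennreal (P n \<omega>) \<partial>M) = ennreal (expectation C ^ n)" for n
  proof -
    have "integrable M (P n)" "(\<integral>\<omega>. P n \<omega> \<partial>M) = (\<Prod>i\<in>{1..n}. expectation C)"
      unfolding P_def
      using M.indep_vars_integrable[OF _ ind] M.indep_vars_lebesgue_integral[OF _ ind] EC by auto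
    then show ?thesis
      using nonneg by (subst nn_integral_eq_integral) auto
  qed
  then have "(\<integral>\<^sup>+ \<omega>. (\<Sum>n. ennreal (P n \<omega>)) \<partial>M) = (\<Sum>n. ennreal (expectation C ^ n))"
    by (subst nn_integral_suminf) auto
  also have "\<dots> \<noteq> \<infinity>"
    using expectation_C summable_geometric[of "expectation C"] by (subst suminf_ennreal_eq[OF _ summable_sums]) auto
  finally have "AE \<omega> in M. (\<Sum>n. ennreal (P n \<omega>)) \<noteq> \<infinity>"
    by (intro nn_integral_PInf_AE) auto
  with nonneg show ?thesis
    unfolding P_def[symmetric]
    by eventually_elim (auto intro!: summable_LIMSEQ_zero summable_suminf_not_top)
qed

text \<open>The bounds on \<open>D\<close> keep [0,1] invariant, and the product of the slopes
  bounds the diameter of its n-th image. The limit has law \<nu> because the characteristic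
  functions of the backward iterates converge both to that of Y, by dominated convergence, and to
  that of \<nu>, by \<open>char_tendsto\<close>.\<close>

lemma backward_iter_limit:
  assumes st: "stationary \<nu>" and D_bounds: "AE w in K. 0 \<le> D w \<and> C w + D w \<le> 1"
  shows "\<exists>Y \<in> borel_measurable M. distr M borel Y = \<nu> \<and>
    (AE \<omega> in M. uniform_limit {0..1} (backward_iter (affine (\<lambda>i. W i \<omega>))) (\<lambda>x. Y \<omega>) sequentially)"
proof (intro bexI conjI)
  \<comment> \<open>\<open>lim\<close> defines Y at every sample point, including those without
    convergence, and is measurable.\<close>
  define Y where "Y \<omega> = lim (\<lambda>n. backward_iter (affine (\<lambda>i. W i \<omega>)) n 0)" for \<omega>
  show Y[measurable]: "Y \<in> borel_measurable M"
    unfolding Y_def by measurable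
  have AE_lim: "AE \<omega> in M. uniform_limit {0..1} (backward_iter (affine (\<lambda>i. W i \<omega>))) (\<lambda>x. Y \<omega>) sequentially \<and>
      (\<lambda>n. backward_iter (affine (\<lambda>i. W i \<omega>)) n 0) \<longlonglongrightarrow> Y \<omega>"
    using AE_W[OF C_bounds] AE_W[OF D_bounds] prod_C_tendsto_0
  proof eventually_elim
    case (elim \<omega>)
    let ?f = "affine (\<lambda>i. W i \<omega>)" and ?P = "\<lambda>n. \<Prod>i\<in>{1..n}. C (W i \<omega>)"
    have maps: "?f i x \<in> {0..1}" if "i \<ge> 1" "x \<in> {0..1}" for i x
    proof -
      have "0 \<le> C (W i \<omega>)"
        using elim(1) that by auto
      then have "C (W i \<omega>) * x \<le> C (W i \<omega>)" "0 \<le> C (W i \<omega>) * x"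
        using that by (auto intro: mult_left_le)
      then show ?thesis
        using elim(2) that by (auto simp: affine_def)
    qed
    have diam: "dist (backward_iter ?f n x) (backward_iter ?f n y) \<le> ?P n" if "x \<in> {0..1}" "y \<in> {0..1}" for n x y
    proof -
      have "\<bar>x - y\<bar> \<le> 1" using that by auto
      moreover have "?P n \<ge> 0" using elim(1) by (auto intro!: prod_nonneg)
      ultimately show ?thesis
        using mult_left_mono[of "\<bar>x - y\<bar>" 1 "?P n"]
        by (simp add: dist_real_def backward_iter_diff abs_mult)
    qed
    show ?case
      using uniform_limit_backward_iter[of "{0..1}" ?f ?P 0, OF maps diam elim(3)]
      unfolding Y_def by (simp add: convergent_LIMSEQ_iff)
  qed
  then show "AE \<omega> in M. uniform_limit {0..1} (backward_iter (affine (\<lambda>i. W i \<omega>))) (\<lambda>x. Y \<omega>) sequentially"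
    by eventually_elim auto
  show "distr M borel Y = \<nu>"
  proof (rule Levy_uniqueness)
    show "real_distribution \<nu>"
      using st by (rule real_distribution_stationary)
    show "char (distr M borel Y) = char \<nu>"
    proof
      fix t
      have "(\<lambda>n. \<integral>\<omega>. iexp (t * backward_iter (affine (\<lambda>i. W i \<omega>)) n 0) \<partial>M) \<longlonglongrightarrow> (\<integral>\<omega>. iexp (t * Y \<omega>) \<partial>M)"
      proof (rule integral_dominated_convergence[where w = "\<lambda>_. 1"])
        show "AE \<omega> in M. (\<lambda>n. iexp (t * backward_iter (affine (\<lambda>i. W i \<omega>)) n 0)) \<longlonglongrightarrow> iexp (t * Y \<omega>)"
          using AE_lim by eventually_elim (auto intro!: tendsto_intros)
      qed auto
      moreover have "(\<lambda>n. \<integral>\<omega>. iexp (t * backward_iter (affine (\<lambda>i. W i \<omega>)) n 0) \<partial>M) \<longlonglongrightarrow> char \<nu> t"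
        using char_tendsto[OF st, of t 0] integral_backward_iter[OF iexp_lipschitz, of t _ 0] by simp
      ultimately have "(\<integral>\<omega>. iexp (t * Y \<omega>) \<partial>M) = char \<nu> t"
        by (rule LIMSEQ_unique)
      then show "char (distr M borel Y) t = char \<nu> t"
        by (simp add: char_def integral_distr)
    qed
  qed simp
qed

end

subsection \<open>The fixed-point equations for the beta and gamma laws\<close>

lemma AE_beta_law: "AE u in beta_law a b. 0 < u \<and> u < 1"
  unfolding beta_law_def by (subst AE_density) auto

lemma ennreal_half_times_double: "ennreal (1 / 2) * (2 * x) = (x :: ennreal)"
proof -
  have "ennreal (1 / 2) * ennreal 2 = ennreal (1 / 2 * 2)"
    by (rule ennreal_mult'[symmetric]) simp
  then have "ennreal (1 / 2) * 2 = 1" by simp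
  then show ?thesis by (simp only: mult.assoc[symmetric] mult_1)
qed

text \<open>\<open>\<mu>\<close> is the law of \<open>(A, B)\<close>, and \<open>u\<close> is the value of \<open>2 L\<close> or \<open>2 R\<close>, according to \<open>I\<^sub>p\<close>.\<close>

locale beta_mixture =
  fixes z :: real and \<mu> :: "(real \<times> real) measure"
  assumes z_pos: "z > 0"
    and sets_mixture [measurable_cong]: "sets \<mu> = sets borel"
    and nn_integral_mixture: "h \<in> borel_measurable borel \<Longrightarrow> (\<integral>\<^sup>+ p. h p \<partial>\<mu>) =
      ennreal (1 / 2) * (\<integral>\<^sup>+ u. h (1 - u / 2, 0) + h (1, u / 2) \<partial>beta_law 1 z)"
begin

abbreviation "\<beta> \<equiv> beta_law (z + 1) (z + 1)"
abbreviation "\<gamma> \<equiv> gamma_law (z + 1)"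

sublocale beta1: prob_space "beta_law 1 z"
  using z_pos by (intro prob_space_beta_law) auto

sublocale beta: prob_space \<beta>
  using z_pos by (intro prob_space_beta_law) auto

sublocale gamma: prob_space \<gamma>
  using z_pos by (intro prob_space_gamma_law) auto

sublocale mixture: prob_space \<mu>
proof
  have "(\<integral>\<^sup>+ u. 1 + 1 \<partial>beta_law 1 z) = 2"
    using beta1.emeasure_space_1 by simp
  then show "emeasure \<mu> (space \<mu>) = 1"
    using nn_integral_mixture[of "\<lambda>_. 1"] ennreal_half_times_double[of 1] by simp
qed

text \<open>Integrate the indicator of the failure of \<open>Q\<close>: both branches contribute 0
  for almost every u.\<close>

lemma AE_mixture:
  assumes Q: "Measurable.pred borel Q"
    and "\<And>u. 0 < u \<Longrightarrow> u < 1 \<Longrightarrow> Q (1 - u / 2, 0) \<and> Q (1, u / 2)"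
  shows "AE p in \<mu>. Q p"
proof -
  note [measurable] = Q
  have "(\<integral>\<^sup>+ p. indicator {p. \<not> Q p} p \<partial>\<mu>) = ennreal (1 / 2) * (\<integral>\<^sup>+ u. 0 \<partial>beta_law 1 z)"
    by (subst nn_integral_mixture, measurable, intro arg_cong2[where f = times] refl nn_integral_cong_AE)
       (use AE_beta_law[of 1 z] in eventually_elim, use assms(2) in auto)
  then have "(\<integral>\<^sup>+ p. indicator {p. \<not> Q p} p \<partial>\<mu>) = 0"
    by simp
  then have "AE p in \<mu>. indicator {p. \<not> Q p} p = (0 :: ennreal)"
    by (subst (asm) nn_integral_0_iff_AE) auto
  then show ?thesis
    by eventually_elim (auto simp: indicator_def split: if_splits)
qed

lemma AE_mixture_bounds: "AE p in \<mu>. 0 \<le> snd p \<and> snd p \<le> fst p \<and> fst p \<le> 1"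
proof (rule AE_mixture)
  show "Measurable.pred borel (\<lambda>p :: real \<times> real. 0 \<le> snd p \<and> snd p \<le> fst p \<and> fst p \<le> 1)"
    unfolding borel_prod[symmetric] by measurable
qed auto

text \<open>The branch (1 - u / 2, 0) has positive weight, and there c < 1 since u > 0 almost
  surely. Here c stands for both A and A - B, which agree on this branch.\<close>

lemma mixture_nontrivial:
  assumes [measurable]: "c \<in> borel_measurable borel" and "\<And>u. c (1 - u / 2, 0) = 1 - u / 2"
  shows "\<not> (AE p in \<mu>. c p = (1 :: real))"
proof
  assume "AE p in \<mu>. c p = 1"
  then have "(\<integral>\<^sup>+ p. ennreal (1 - c p) \<partial>\<mu>) = (\<integral>\<^sup>+ p. 0 \<partial>\<mu>)"
    by (intro nn_integral_cong_AE) auto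
  then have "(\<integral>\<^sup>+ u. ennreal (u / 2) + ennreal (1 - c (1, u / 2)) \<partial>beta_law 1 z) = 0"
    by (subst (asm) nn_integral_mixture) (auto simp: assms(2))
  then have "AE u in beta_law 1 z. ennreal (u / 2) + ennreal (1 - c (1, u / 2)) = 0"
    by (subst (asm) nn_integral_0_iff_AE) auto
  with AE_beta_law[of 1 z] have "AE u in beta_law 1 z. False"
    by eventually_elim auto
  then show False by simp
qed

section \<open>The two random affine maps driven by the mixture\<close>

lemma measurable_mixture [measurable (raw)]:
  "(\<lambda>q. fst (f q)) \<in> borel_measurable N" "(\<lambda>q. snd (f q)) \<in> borel_measurable N"
  if "f \<in> N \<rightarrow>\<^sub>M \<mu>"
proof -
  have f: "f \<in> N \<rightarrow>\<^sub>M borel \<Otimes>\<^sub>M borel"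
    using that by (simp add: measurable_cong_sets[OF refl sets_mixture] borel_prod)
  from f show "(\<lambda>q. fst (f q)) \<in> borel_measurable N" by measurable
  from f show "(\<lambda>q. snd (f q)) \<in> borel_measurable N" by measurable
qed

sublocale X: random_affine_map \<mu> "\<lambda>p. fst p - snd p" snd
proof
  show "(\<lambda>p. fst p - snd p) \<in> borel_measurable \<mu>" "snd \<in> borel_measurable \<mu>"
    unfolding measurable_cong_sets[OF sets_mixture refl] borel_prod[symmetric] by measurable
  show "AE p in \<mu>. 0 \<le> fst p - snd p \<and> fst p - snd p \<le> 1"
    using AE_mixture_bounds by eventually_elim auto
  show "\<not> (AE p in \<mu>. fst p - snd p = 1)"
    by (rule mixture_nontrivial) (auto simp: borel_prod[symmetric])
qed

sublocale GM: pair_prob_space \<gamma> \<mu> ..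

sublocale V: random_affine_map "\<gamma> \<Otimes>\<^sub>M \<mu>" "\<lambda>q. fst (snd q)" "\<lambda>q. snd (snd q) * fst q"
proof
  show "(\<lambda>q. fst (snd q)) \<in> borel_measurable (\<gamma> \<Otimes>\<^sub>M \<mu>)"
    "(\<lambda>q. snd (snd q) * fst q) \<in> borel_measurable (\<gamma> \<Otimes>\<^sub>M \<mu>)"
    by measurable
  have "AE p in \<mu>. 0 \<le> fst p \<and> fst p \<le> 1"
    using AE_mixture_bounds by eventually_elim auto
  moreover have "{q \<in> space (\<gamma> \<Otimes>\<^sub>M \<mu>). 0 \<le> fst (snd q) \<and> fst (snd q) \<le> 1} \<in> sets (\<gamma> \<Otimes>\<^sub>M \<mu>)"
    by measurable
  ultimately show "AE q in \<gamma> \<Otimes>\<^sub>M \<mu>. 0 \<le> fst (snd q) \<and> fst (snd q) \<le> 1"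
    by (intro GM.AE_pair_measure) auto
  show "\<not> (AE q in \<gamma> \<Otimes>\<^sub>M \<mu>. fst (snd q) = 1)"
  proof
    assume "AE q in \<gamma> \<Otimes>\<^sub>M \<mu>. fst (snd q) = 1"
    \<comment> \<open>The condition does not involve v, so Fubini reduces it to the mixture
      alone.\<close>
    from GM.AE_pair[OF this] have "AE v in \<gamma>. AE p in \<mu>. fst p = 1" by simp
    then have "AE p in \<mu>. fst p = 1" by simp
    moreover have "\<not> (AE p in \<mu>. fst p = 1)"
      by (rule mixture_nontrivial) (auto simp: borel_prod[symmetric])
    ultimately show False by simp
  qed
qed

section \<open>The random equations as stationarity, and their solutions\<close>

lemma solves_X_eq_iff_stationary: "solves_X_eq \<mu> \<nu> \<longleftrightarrow> X.stationary \<nu>"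
proof -
  have "(\<lambda>(x, A, B). A * x + B * (1 - x)) = (\<lambda>(x, p). (fst p - snd p) * x + snd p :: real)"
    by (auto simp: algebra_simps)
  then show ?thesis
    by (simp add: solves_X_eq_def X.stationary_def)
qed

lemma solves_V_eq_iff_stationary: "solves_V_eq \<mu> \<gamma> \<nu> \<longleftrightarrow> V.stationary \<nu>"
proof -
  have "(\<lambda>(v1, v2, A, B). A * v1 + B * v2) = (\<lambda>(x, q). fst (snd q) * x + snd (snd q) * fst q :: real)"
    by auto
  then show ?thesis
    by (simp add: solves_V_eq_def V.stationary_def)
qed

text \<open>The two branches of the mixture turn A x + B (1 - x) into the two kernels of
  \<open>beta_law_fixed_point\<close>; the weight 1 / 2 cancels the factor 2 there.\<close>

lemma nn_integral_X_map:
  assumes [measurable]: "g \<in> borel_measurable borel"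
  shows "(\<integral>\<^sup>+ x. \<integral>\<^sup>+ p. g (fst p * x + snd p * (1 - x)) \<partial>\<mu> \<partial>\<beta>) = (\<integral>\<^sup>+ x. g x \<partial>\<beta>)"
proof -
  have "(\<integral>\<^sup>+ x. \<integral>\<^sup>+ p. g (fst p * x + snd p * (1 - x)) \<partial>\<mu> \<partial>\<beta>) =
      (\<integral>\<^sup>+ x. ennreal (1 / 2) * (\<integral>\<^sup>+ u. g ((1 - u / 2) * x) + g (x + u / 2 * (1 - x)) \<partial>beta_law 1 z) \<partial>\<beta>)"
    by (subst nn_integral_mixture) (auto simp: borel_prod[symmetric])
  also have "\<dots> = ennreal (1 / 2) *
      (\<integral>\<^sup>+ x. \<integral>\<^sup>+ u. g ((1 - u / 2) * x) + g (x + u / 2 * (1 - x)) \<partial>beta_law 1 z \<partial>\<beta>)"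
    by (rule nn_integral_cmult) measurable
  also have "\<dots> = (\<integral>\<^sup>+ x. g x \<partial>\<beta>)"
    unfolding beta_law_fixed_point[OF z_pos assms] by (rule ennreal_half_times_double)
  finally show ?thesis .
qed

lemma stationary_beta: "X.stationary \<beta>"
  unfolding X.stationary_def
proof (intro conjI measure_eqI)
  fix E assume "E \<in> sets \<beta>"
  then have [measurable]: "E \<in> sets borel" by simp
  have "emeasure (distr (\<beta> \<Otimes>\<^sub>M \<mu>) borel (\<lambda>(x, p). (fst p - snd p) * x + snd p)) E =
      (\<integral>\<^sup>+ y. indicator E y \<partial>distr (\<beta> \<Otimes>\<^sub>M \<mu>) borel (\<lambda>(x, p). (fst p - snd p) * x + snd p))"
    by simp
  also have "\<dots> = (\<integral>\<^sup>+ x. \<integral>\<^sup>+ p. indicator E ((fst p - snd p) * x + snd p) \<partial>\<mu> \<partial>\<beta>)"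
    by (subst nn_integral_distr, measurable, subst mixture.nn_integral_fst[symmetric])
       (auto simp: case_prod_unfold)
  also have "\<dots> = (\<integral>\<^sup>+ x. \<integral>\<^sup>+ p. indicator E (fst p * x + snd p * (1 - x)) \<partial>\<mu> \<partial>\<beta>)"
    by (simp add: algebra_simps)
  also have "\<dots> = emeasure \<beta> E"
    by (subst nn_integral_X_map) auto
  finally show "emeasure \<beta> E = emeasure (distr (\<beta> \<Otimes>\<^sub>M \<mu>) borel (\<lambda>(x, p). (fst p - snd p) * x + snd p)) E" ..
qed (auto simp: beta.prob_space_axioms)

text \<open>With \<open>S = V\<^sub>1 + V\<^sub>2\<close> and \<open>X = V\<^sub>1 / S\<close>, the variable \<open>A V\<^sub>1 + B V\<^sub>2\<close> is \<open>S (A X + B (1 - X))\<close>, and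
  \<open>A X + B (1 - X)\<close> may be replaced by \<open>X\<close>.\<close>

lemma stationary_gamma: "V.stationary \<gamma>"
  unfolding V.stationary_def
proof (intro conjI measure_eqI)
  fix E assume "E \<in> sets \<gamma>"
  then have [measurable]: "E \<in> sets borel" by simp
  have z1: "z + 1 > 0" using z_pos by simp
  have [measurable]: "(\<lambda>(v, w). \<integral>\<^sup>+ p. indicator E (fst p * v + snd p * w) \<partial>\<mu>)
      \<in> borel_measurable (borel \<Otimes>\<^sub>M borel)"
    by measurable
  have "emeasure (distr (\<gamma> \<Otimes>\<^sub>M (\<gamma> \<Otimes>\<^sub>M \<mu>)) borel (\<lambda>(x, q). fst (snd q) * x + snd (snd q) * fst q)) E =
      (\<integral>\<^sup>+ y. indicator E y \<partial>distr (\<gamma> \<Otimes>\<^sub>M (\<gamma> \<Otimes>\<^sub>M \<mu>)) borel (\<lambda>(x, q). fst (snd q) * x + snd (snd q) * fst q))"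
    by simp
  also have "\<dots> = (\<integral>\<^sup>+ v. \<integral>\<^sup>+ w. \<integral>\<^sup>+ p. indicator E (fst p * v + snd p * w) \<partial>\<mu> \<partial>\<gamma> \<partial>\<gamma>)"
    by (subst nn_integral_distr, measurable, subst GM.P.nn_integral_fst[symmetric], measurable)
       (auto simp: mixture.nn_integral_fst[symmetric])
  also have "\<dots> = (\<integral>\<^sup>+ s. \<integral>\<^sup>+ x. \<integral>\<^sup>+ p. indicator E (fst p * (s * x) + snd p * (s * (1 - x))) \<partial>\<mu>
      \<partial>\<beta> \<partial>gamma_law ((z + 1) + (z + 1)))"
    by (rule beta_gamma_algebra[OF z1 z1]) measurable
  also have "\<dots> = (\<integral>\<^sup>+ s. \<integral>\<^sup>+ x. \<integral>\<^sup>+ p. indicator E (s * (fst p * x + snd p * (1 - x))) \<partial>\<mu>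
      \<partial>\<beta> \<partial>gamma_law ((z + 1) + (z + 1)))"
    by (simp add: algebra_simps)
  \<comment> \<open>For each fixed s, stationarity of the beta law is applied to the test function x
    \<mapsto> \<open>indicator E (s * x)\<close>.\<close>
  also have "\<dots> = (\<integral>\<^sup>+ s. \<integral>\<^sup>+ x. indicator E (s * x) \<partial>\<beta> \<partial>gamma_law ((z + 1) + (z + 1)))"
    by (subst nn_integral_X_map) auto
  \<comment> \<open>The change of variables is undone with a test function of v = s x only.\<close>
  also have "\<dots> = (\<integral>\<^sup>+ v. \<integral>\<^sup>+ w. indicator E v \<partial>\<gamma> \<partial>\<gamma>)"
    by (rule beta_gamma_algebra[OF z1 z1, symmetric]) measurable
  also have "\<dots> = emeasure \<gamma> E"
    using gamma.emeasure_space_1 by simp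
  finally show "emeasure \<gamma> E =
    emeasure (distr (\<gamma> \<Otimes>\<^sub>M (\<gamma> \<Otimes>\<^sub>M \<mu>)) borel (\<lambda>(x, q). fst (snd q) * x + snd (snd q) * fst q)) E" ..
qed (auto simp: gamma.prob_space_axioms)

end

text \<open>Condition on \<open>I\<close>. Each branch involves only one of L and R, so their joint
  law enters through its marginals alone, whatever the dependence.\<close>

lemma (in prob_space) nn_integral_fair_mixture:
  fixes L R :: "'a \<Rightarrow> real"
  assumes I: "distr M (count_space UNIV) I = measure_pmf (bernoulli_pmf (1 / 2))"
    and ind: "indep_rv (count_space UNIV) I borel (\<lambda>\<omega>. (L \<omega>, R \<omega>))"
    and L: "distr M borel (\<lambda>\<omega>. 2 * L \<omega>) = \<rho>" and R: "distr M borel (\<lambda>\<omega>. 2 * R \<omega>) = \<rho>"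
    and h: "h \<in> borel_measurable borel"
  shows "(\<integral>\<^sup>+ p. h p \<partial>distr M borel
      (\<lambda>\<omega>. of_bool (I \<omega>) *\<^sub>R (1 - L \<omega>, 0) + (1 - of_bool (I \<omega>)) *\<^sub>R (1, R \<omega>))) =
    ennreal (1 / 2) * (\<integral>\<^sup>+ u. h (1 - u / 2, 0) + h (1, u / 2) \<partial>\<rho>)"
proof -
  have I_measurable [measurable]: "I \<in> M \<rightarrow>\<^sub>M count_space UNIV"
    and "(\<lambda>\<omega>. (L \<omega>, R \<omega>)) \<in> M \<rightarrow>\<^sub>M borel \<Otimes>\<^sub>M borel"
    using ind by (auto simp: indep_rv_def borel_prod)
  note LR [measurable] = this(2)
  have [measurable]: "L \<in> borel_measurable M" "R \<in> borel_measurable M"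
    using measurable_compose[OF LR measurable_fst] measurable_compose[OF LR measurable_snd] by simp_all
  have [measurable]: "h \<in> borel_measurable (borel \<Otimes>\<^sub>M borel)"
    using h by (simp add: borel_prod)
  have sets_\<rho> [measurable_cong]: "sets \<rho> = sets borel"
    using L by (metis sets_distr)
  define H where "H i lr = (if i then h (1 - fst lr, 0) else h (1, snd lr))" for i and lr :: "real \<times> real"
  have [measurable]: "case_prod H \<in> borel_measurable (count_space UNIV \<Otimes>\<^sub>M (borel \<Otimes>\<^sub>M borel))"
    unfolding H_def by measurable
  interpret LR: prob_space "distr M (borel \<Otimes>\<^sub>M borel) (\<lambda>\<omega>. (L \<omega>, R \<omega>))"
    by (rule prob_space_distr) measurable
  have "(\<lambda>\<omega>. of_bool (I \<omega>) *\<^sub>R (1 - L \<omega>, 0) + (1 - of_bool (I \<omega>)) *\<^sub>R (1, R \<omega>)) =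
      (\<lambda>\<omega>. if I \<omega> then (1 - L \<omega>, 0) else (1, R \<omega>))"
    by auto
  moreover have "(\<lambda>\<omega>. if I \<omega> then (1 - L \<omega>, 0) else (1, R \<omega>)) \<in> M \<rightarrow>\<^sub>M borel \<Otimes>\<^sub>M borel"
    by measurable
  ultimately have "(\<integral>\<^sup>+ p. h p \<partial>distr M borel
      (\<lambda>\<omega>. of_bool (I \<omega>) *\<^sub>R (1 - L \<omega>, 0) + (1 - of_bool (I \<omega>)) *\<^sub>R (1, R \<omega>))) =
      (\<integral>\<^sup>+ \<omega>. H (I \<omega>) (L \<omega>, R \<omega>) \<partial>M)"
    using h by (auto simp: nn_integral_distr borel_prod H_def intro!: nn_integral_cong)
  also have "\<dots> = (\<integral>\<^sup>+ p. case_prod H p \<partial>distr M (count_space UNIV \<Otimes>\<^sub>M (borel \<Otimes>\<^sub>M borel)) (\<lambda>\<omega>. (I \<omega>, L \<omega>, R \<omega>)))"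
    by (subst nn_integral_distr) auto
  also have "\<dots> = (\<integral>\<^sup>+ p. case_prod H p \<partial>(measure_pmf (bernoulli_pmf (1 / 2)) \<Otimes>\<^sub>M distr M (borel \<Otimes>\<^sub>M borel) (\<lambda>\<omega>. (L \<omega>, R \<omega>))))"
    using indep_rv_distr[OF ind] by (simp add: I borel_prod)
  also have "\<dots> = (\<integral>\<^sup>+ i. \<integral>\<^sup>+ lr. H i lr \<partial>distr M (borel \<Otimes>\<^sub>M borel) (\<lambda>\<omega>. (L \<omega>, R \<omega>)) \<partial>measure_pmf (bernoulli_pmf (1 / 2)))"
    by (subst LR.nn_integral_fst[symmetric]) auto
  also have "\<dots> = ennreal (1 / 2) * ((\<integral>\<^sup>+ \<omega>. h (1 - L \<omega>, 0) \<partial>M) + (\<integral>\<^sup>+ \<omega>. h (1, R \<omega>) \<partial>M))"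
    by (simp add: H_def nn_integral_distr distrib_left mult.commute)
  also have "(\<integral>\<^sup>+ \<omega>. h (1 - L \<omega>, 0) \<partial>M) = (\<integral>\<^sup>+ u. h (1 - u / 2, 0) \<partial>\<rho>)"
    unfolding L[symmetric] by (subst nn_integral_distr) auto
  also have "(\<integral>\<^sup>+ \<omega>. h (1, R \<omega>) \<partial>M) = (\<integral>\<^sup>+ u. h (1, u / 2) \<partial>\<rho>)"
    unfolding R[symmetric] by (subst nn_integral_distr) auto
  also have "(\<integral>\<^sup>+ u. h (1 - u / 2, 0) \<partial>\<rho>) + (\<integral>\<^sup>+ u. h (1, u / 2) \<partial>\<rho>) =
      (\<integral>\<^sup>+ u. h (1 - u / 2, 0) + h (1, u / 2) \<partial>\<rho>)"
    by (rule nn_integral_add[symmetric]) measurable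
  finally show ?thesis .
qed

theorem theorem5:
  fixes z p a b :: real
    and N :: "'n measure" and I :: "'n \<Rightarrow> bool" and L R :: "'n \<Rightarrow> real"
    and \<mu> :: "(real \<times> real) measure"
    and M :: "'m measure" and A B V :: "nat \<Rightarrow> 'm \<Rightarrow> real"
  assumes "z > 0" and "p = 1 / 2" and "a = z + 1" and "b = z + 1"
    and "prob_space N"
    and "distr N (count_space UNIV) I = measure_pmf (bernoulli_pmf p)"
    and "\<And>\<omega>. \<omega> \<in> space N \<Longrightarrow> (L \<omega>, R \<omega>) \<in> {0..<1} \<times> {0..<1}"
    and "prob_space.indep_rv N (count_space UNIV) I borel (\<lambda>\<omega>. (L \<omega>, R \<omega>))"
    and "distr N borel (\<lambda>\<omega>. 2 * L \<omega>) = beta_law 1 z"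
    and "distr N borel (\<lambda>\<omega>. 2 * R \<omega>) = beta_law 1 z"
    and "\<mu> = distr N borel
           (\<lambda>\<omega>. of_bool (I \<omega>) *\<^sub>R (1 - L \<omega>, 0) + (1 - of_bool (I \<omega>)) *\<^sub>R (1, R \<omega>))"
    and "prob_space M"
    and "prob_space.indep_vars M (\<lambda>_. borel) (\<lambda>n \<omega>. ((A n \<omega>, B n \<omega>), V n \<omega>)) {1..}"
    and "\<And>n. n \<ge> 1 \<Longrightarrow>
           distr M borel (\<lambda>\<omega>. ((A n \<omega>, B n \<omega>), V n \<omega>)) = \<mu> \<Otimes>\<^sub>M gamma_law b"
  defines "F \<equiv> \<lambda>\<omega> n. F_map (A n \<omega>) (B n \<omega>)"
    and "G \<equiv> \<lambda>\<omega> n. G_map (A n \<omega>) (B n \<omega>) (V n \<omega>)"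
  shows "(\<forall>\<nu>. solves_V_eq \<mu> (gamma_law b) \<nu> \<longleftrightarrow> \<nu> = gamma_law a)
    \<and> (\<forall>\<nu>. solves_X_eq \<mu> \<nu> \<longleftrightarrow> \<nu> = beta_law a b)
    \<and> (\<exists>Y \<in> borel_measurable M. distr M borel Y = beta_law a b \<and>
         (AE \<omega> in M. uniform_limit {0..1} (\<lambda>n. backward_iter (F \<omega>) n) (\<lambda>x. Y \<omega>) sequentially))
    \<and> (\<forall>x \<in> {0..1}. weak_conv_m (\<lambda>n. distr M borel (\<lambda>\<omega>. forward_iter (F \<omega>) n x)) (beta_law a b))
    \<and> (\<forall>x' \<in> {0<..}. weak_conv_m (\<lambda>n. distr M borel (\<lambda>\<omega>. forward_iter (G \<omega>) n x')) (gamma_law a))"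
proof -
  interpret N: prob_space N by fact
  interpret M: prob_space M by fact
  interpret beta_mixture z \<mu>
  proof
    show "sets \<mu> = sets borel" using assms(11) by simp
    show "(\<integral>\<^sup>+ p. h p \<partial>\<mu>) =
        ennreal (1 / 2) * (\<integral>\<^sup>+ u. h (1 - u / 2, 0) + h (1, u / 2) \<partial>beta_law 1 z)"
      if "h \<in> borel_measurable borel" for h
      unfolding assms(11)
      by (rule N.nn_integral_fair_mixture[OF assms(6)[unfolded assms(2)] assms(8-10) that])
  qed fact
  let ?T = "\<lambda>n \<omega>. ((A n \<omega>, B n \<omega>), V n \<omega>)"
  have T: "?T n \<in> M \<rightarrow>\<^sub>M borel" if "n \<ge> 1" for n
    using assms(13) that by (auto simp: M.indep_vars_def)
  have [measurable]: "fst \<in> (borel :: ((real \<times> real) \<times> real) measure) \<rightarrow>\<^sub>M \<mu>"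
    unfolding measurable_cong_sets[OF refl sets_mixture] borel_prod[symmetric] by measurable
  \<comment> \<open>The given triples are ordered ((A, B), V), while the second affine map is driven
    by (V, (A, B)); swapping passes independence and laws from one order to the other.\<close>
  have [measurable]: "prod.swap \<in> (borel :: ((real \<times> real) \<times> real) measure) \<rightarrow>\<^sub>M \<gamma> \<Otimes>\<^sub>M \<mu>"
    unfolding prod.swap_def
  proof (rule measurable_Pair)
    show "snd \<in> (borel :: ((real \<times> real) \<times> real) measure) \<rightarrow>\<^sub>M \<gamma>"
      unfolding measurable_cong_sets[OF refl sets_gamma_law] borel_prod[symmetric] by measurable
  qed measurable
  have swap: "prod.swap = (\<lambda>(x, y). (y, x))"
    by (auto simp: fun_eq_iff)
  interpret X: iid_affine_maps \<mu> "\<lambda>p. fst p - snd p" snd M "\<lambda>n \<omega>. (A n \<omega>, B n \<omega>)"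
  proof
    show "M.indep_vars (\<lambda>_. \<mu>) (\<lambda>n \<omega>. (A n \<omega>, B n \<omega>)) {1..}"
      using M.indep_vars_compose2[OF assms(13), of "\<lambda>_. fst" "\<lambda>_. \<mu>"] by simp
    fix n :: nat assume n: "n \<ge> 1"
    have "distr M \<mu> (\<lambda>\<omega>. (A n \<omega>, B n \<omega>)) = distr (distr M borel (?T n)) \<mu> fst"
      using T[OF n] by (subst distr_distr) (auto simp: comp_def)
    also have "\<dots> = distr (\<mu> \<Otimes>\<^sub>M \<gamma>) \<mu> fst"
      using assms(14)[OF n] assms(4) by simp
    also have "\<dots> = \<mu>"
      by (rule gamma.distr_pair_fst)
    finally show "distr M \<mu> (\<lambda>\<omega>. (A n \<omega>, B n \<omega>)) = \<mu>" .
  qed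
  interpret V: iid_affine_maps "\<gamma> \<Otimes>\<^sub>M \<mu>" "\<lambda>q. fst (snd q)" "\<lambda>q. snd (snd q) * fst q" M
    "\<lambda>n \<omega>. (V n \<omega>, A n \<omega>, B n \<omega>)"
  proof
    show "M.indep_vars (\<lambda>_. \<gamma> \<Otimes>\<^sub>M \<mu>) (\<lambda>n \<omega>. (V n \<omega>, A n \<omega>, B n \<omega>)) {1..}"
      using M.indep_vars_compose2[OF assms(13), of "\<lambda>_. prod.swap" "\<lambda>_. \<gamma> \<Otimes>\<^sub>M \<mu>"] by simp
    fix n :: nat assume n: "n \<ge> 1"
    have "distr M (\<gamma> \<Otimes>\<^sub>M \<mu>) (\<lambda>\<omega>. (V n \<omega>, A n \<omega>, B n \<omega>)) = distr (distr M borel (?T n)) (\<gamma> \<Otimes>\<^sub>M \<mu>) prod.swap"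
      using T[OF n] by (subst distr_distr) (auto simp: comp_def)
    also have "\<dots> = distr (\<mu> \<Otimes>\<^sub>M \<gamma>) (\<gamma> \<Otimes>\<^sub>M \<mu>) (\<lambda>(x, y). (y, x))"
      using assms(14)[OF n] assms(4) by (simp add: swap)
    also have "\<dots> = \<gamma> \<Otimes>\<^sub>M \<mu>"
      by (rule GM.distr_pair_swap[symmetric])
    finally show "distr M (\<gamma> \<Otimes>\<^sub>M \<mu>) (\<lambda>\<omega>. (V n \<omega>, A n \<omega>, B n \<omega>)) = \<gamma> \<Otimes>\<^sub>M \<mu>" .
  qed
  have F: "F \<omega> = X.affine (\<lambda>n. (A n \<omega>, B n \<omega>))" for \<omega>
    by (simp add: F_def F_map_def X.affine_def fun_eq_iff algebra_simps)
  have G: "G \<omega> = V.affine (\<lambda>n. (V n \<omega>, A n \<omega>, B n \<omega>))" for \<omega>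
    by (simp add: G_def G_map_def V.affine_def fun_eq_iff)
  \<comment> \<open>For the first affine map C + D = A, so the invariance of [0,1] amounts to 0
    \<le> B and A \<le> 1, given 0 \<le> C.\<close>
  have "AE p in \<mu>. 0 \<le> snd p \<and> fst p - snd p + snd p \<le> 1"
    using AE_mixture_bounds by eventually_elim auto
  from X.backward_iter_limit[OF stationary_beta this] show ?thesis
    unfolding F G assms(3,4) solves_X_eq_iff_stationary solves_V_eq_iff_stationary
    using V.stationary_unique[OF stationary_gamma] stationary_gamma
      X.stationary_unique[OF stationary_beta] stationary_beta
      X.weak_conv_forward_iter[OF stationary_beta] V.weak_conv_forward_iter[OF stationary_gamma]
    by blast
qed

end
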